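(* Let $p_1$ and $p_2$ be distinct primes and $k=p_1p_2$. Let $A$ be a finite subset of $\mathbb{Z}$ with $|A|\geq (k-1)^{2}\,k!$. Then $$|A+k\cdot A|\geq (k+1)|A|-\lceil k(k+2)/4\rceil .$$
   Context: For a finite set $A\subseteq\mathbb{Z}$ and a positive integer $k$, $k\cdot A=\{ka: a\in A\}$ is the dilate of $A$ by $k$, and $A+k\cdot A=\{a+kb: a,b\in A\}$. *)

theory Defs
  imports
    Complex_Main
    "HOL-Library.Set_Algebras"
    "HOL-Computational_Algebra.Primes"
begin

end

theory Submission
  imports Defs "HOL-Number_Theory.Cong"
begin

text \<open>
  Split \<open>A\<close> into its residue classes modulo \<open>k\<close>: a class \<open>i\<close> is \<open>k X + i\<close> for a
  fibre \<open>X = X i\<close>, and \<open>|A + k \<cdot> A|\<close> is the sum over the \<open>j\<close> occurring classes of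
  \<open>|X i + A|\<close>. The sumset \<open>X i + A\<close> contains a translate of \<open>X i + k \<cdot> X i\<close>, to which
  an inductive bound applies, and whatever else it contains is extra gain. After an affine
  change of coordinates, \<open>A\<close> is constant modulo neither prime.

  The extra gain comes from residues modulo \<open>k\<close>. If shifting the residues of \<open>X i\<close> by
  \<open>l - i\<close> leaves their set, the part of \<open>A\<close> in class \<open>l\<close> contributes a translate
  that is entirely new. For prime \<open>k\<close> this fails only if \<open>X i\<close> is full, that is, meets
  all residues. For \<open>k = p q\<close> there is a third possibility: the residues of \<open>X i\<close> are
  invariant under the shift by a prime \<open>q\<close>, and \<open>q\<close> divides \<open>l - i\<close>. Then classes
  \<open>m\<close> with \<open>m \<noteq> i\<close> modulo \<open>q\<close> contribute \<open>p\<close> new translates each (\<open>f_stab\<close>).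
  If all of those classes are small this may still be too little, but then such a class \<open>m\<close>
  itself has a huge excess, because \<open>X m + A\<close> sees all the large classes congruent
  to \<open>i\<close> modulo \<open>q\<close> at once (\<open>f_outside\<close>). The combinatorics of trading these
  excesses against each other is isolated in the locale \<open>surplus\<close>.

  This is used twice. First, it yields by induction on \<open>t\<close> the weak bound
  \<open>|X + k \<cdot> X| \<ge> t |X| - k (t - 2)!\<close> for \<open>2 \<le> t \<le> k + 1\<close> and nonempty \<open>X\<close>
  (\<open>dilate_slope_bound\<close>): a set with at least \<open>t\<close> occurring classes satisfies the
  next bound by the trivial estimate \<open>|A| + j (|A| - 1)\<close>, and with fewer classes the total
  excess is large enough to raise the slope by one, at the price of multiplying the constant by at
  most \<open>t - 1\<close>. The last constant is \<open>k!\<close>. Secondly, if some fibre is not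
  full, the total excess over slope \<open>k + 1\<close> is at least the size of the largest class
  (\<open>gain_if_not_full\<close>), which for \<open>|A| \<ge> (k - 1)^2 k!\<close> and \<open>j < k\<close>
  outweighs the constant \<open>j k!\<close> that is lost. If every fibre is full, counting the elements
  of \<open>X i + A\<close> below and above the translate of the own class gives
  \<open>(k + 1) |A| - j (k + 1 - j)\<close> (\<open>bound_if_all_full\<close>), and
  \<open>j (k + 1 - j) \<le> (k + 1)^2 / 4\<close>.
\<close>

section \<open>Cardinalities of sumsets\<close>

lemma finite_sumset: "finite X \<Longrightarrow> finite Y \<Longrightarrow> finite (X + Y)" for X Y :: "int set"
  by (rule finite_set_plus)

lemma card_translate_sumset:
  fixes X Y :: "int set"
  shows "card (X + ((+) r) ` Y) = card (X + Y)"
proof -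
  have "X + ((+) r) ` Y = ((+) r) ` (X + Y)"
    unfolding set_plus_image by (force simp: image_iff ac_simps)
  then show ?thesis by (simp add: card_image)
qed

text \<open>
  The translates of \<open>X\<close> by the minimum of \<open>C\<close> and of \<open>C\<close> by the maximum of
  \<open>X\<close> meet only in the point where one ends and the other begins.
\<close>

lemma card_sumset_ge:
  fixes X C :: "int set"
  assumes "finite X" "X \<noteq> {}" "finite C" "C \<noteq> {}"
  shows "int (card X) + int (card C) - 1 \<le> int (card (X + C))"
proof -
  let ?L = "(\<lambda>x. x + Min C) ` X" and ?R = "(\<lambda>c. Max X + c) ` C"
  have "?L \<union> ?R \<subseteq> X + C"
    using assms by (auto intro!: set_plus_intro Min_in Max_in)
  then have le: "card (?L \<union> ?R) \<le> card (X + C)"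
    by (intro card_mono finite_sumset assms)
  have "?L \<inter> ?R \<subseteq> {Max X + Min C}"
  proof
    fix y assume "y \<in> ?L \<inter> ?R"
    then obtain x c where "x \<in> X" "c \<in> C" "y = x + Min C" "y = Max X + c" by auto
    moreover from this assms have "x \<le> Max X" "Min C \<le> c" by auto
    ultimately show "y \<in> {Max X + Min C}" by auto
  qed
  then have "card (?L \<inter> ?R) \<le> 1"
    by (metis card_mono card.empty card_insert_if empty_iff finite.emptyI finite.insertI One_nat_def)
  moreover have "card ?L + card ?R = card (?L \<union> ?R) + card (?L \<inter> ?R)"
    using assms by (intro card_Un_Int) auto
  moreover have "card ?L = card X" "card ?R = card C"
    by (auto intro!: card_image inj_onI)
  ultimately show ?thesis using le by linarith
qed

lemma sum_card_mod_classes: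
  fixes X :: "int set"
  assumes "finite X"
  shows "card X = (\<Sum>r\<in>(\<lambda>x. x mod m) ` X. card {x\<in>X. x mod m = r})"
proof -
  have "X = (\<Union>r\<in>(\<lambda>x. x mod m) ` X. {x\<in>X. x mod m = r})" by auto
  then have "card X = card (\<Union>r\<in>(\<lambda>x. x mod m) ` X. {x\<in>X. x mod m = r})" by simp
  also have "\<dots> = (\<Sum>r\<in>(\<lambda>x. x mod m) ` X. card {x\<in>X. x mod m = r})"
    using assms by (intro card_UN_disjoint) auto
  finally show ?thesis .
qed

text \<open>
  When \<open>C\<close> lies in one residue class, the parts of \<open>X\<close> in different classes have
  disjoint sumsets with \<open>C\<close>, and the basic bound applies to each part separately.
\<close>

lemma card_sumset_residue_class_ge:
  fixes X C :: "int set"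
  assumes X: "finite X" and C: "finite C" "C \<noteq> {}"
    and cls: "\<And>c. c \<in> C \<Longrightarrow> [c = b] (mod m)"
  shows "int (card X) + int (card ((\<lambda>x. x mod m) ` X)) * (int (card C) - 1) \<le> int (card (X + C))"
proof -
  let ?R = "(\<lambda>x. x mod m) ` X" and ?X = "\<lambda>r. {x\<in>X. x mod m = r}"
  have dis: "(?X r + C) \<inter> (?X r' + C) = {}" if "r \<noteq> r'" for r r'
  proof (rule ccontr)
    assume "(?X r + C) \<inter> (?X r' + C) \<noteq> {}"
    then obtain x c x' c' where h: "x mod m = r" "x' mod m = r'" "c \<in> C" "c' \<in> C" "x + c = x' + c'"
      by (auto elim!: set_plus_elim)
    then have "[c = c'] (mod m)" using cls by (meson cong_sym cong_trans)
    then have "[x = x'] (mod m)" using h(5) by (metis cong_add_rcancel cong_add_lcancel cong_refl cong_sym)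
    with h that show False by (simp add: cong_def)
  qed
  have "int (card X) + int (card ?R) * (int (card C) - 1)
      = (\<Sum>r\<in>?R. int (card (?X r)) + int (card C) - 1)"
    by (subst sum_card_mod_classes[OF X, of m]) (simp add: sum.distrib sum_subtractf algebra_simps)
  also have "\<dots> \<le> (\<Sum>r\<in>?R. int (card (?X r + C)))"
    using X C by (intro sum_mono card_sumset_ge) auto
  also have "\<dots> = int (card (\<Union>r\<in>?R. ?X r + C))"
    using X C dis by (subst card_UN_disjoint) (auto intro!: finite_sumset)
  also have "(\<Union>r\<in>?R. ?X r + C) = X + C"
    by (force elim!: set_plus_elim intro: set_plus_intro)
  finally show ?thesis .
qed

lemma card_sumset_gain:
  fixes X A B Y C :: "int set"
  assumes "finite X" "finite A" "B \<subseteq> A" "Y \<subseteq> X" "C \<subseteq> A"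
    and "(Y + C) \<inter> (X + B) = {}"
  shows "int (card (X + B)) + int (card (Y + C)) \<le> int (card (X + A))"
proof -
  have fin: "finite (X + B)" "finite (Y + C)" "finite (X + A)"
    using assms by (auto intro!: finite_sumset intro: finite_subset)
  have "card (X + B) + card (Y + C) = card ((X + B) \<union> (Y + C))"
    using fin assms(6) by (subst card_Un_disjoint) auto
  also have "\<dots> \<le> card (X + A)"
    using assms fin by (intro card_mono Un_least set_plus_mono2) auto
  finally show ?thesis by simp
qed

section \<open>Sets of integers modulo m and their shifts\<close>

text \<open>
  A set that covers all residues modulo \<open>k\<close> is called full in the explanations.
\<close>

definition covers :: "int set \<Rightarrow> int \<Rightarrow> bool"
  where "covers X m \<longleftrightarrow> (\<forall>r. \<exists>x\<in>X. [x = r] (mod m))"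

definition shift_invariant :: "int set \<Rightarrow> int \<Rightarrow> int \<Rightarrow> bool"
  where "shift_invariant X m d \<longleftrightarrow> (\<forall>x\<in>X. \<exists>y\<in>X. [y = x + d] (mod m))"

lemma shift_invariant_cong:
  "shift_invariant X m d \<Longrightarrow> [d = e] (mod m) \<Longrightarrow> shift_invariant X m e"
  unfolding shift_invariant_def by (meson cong_add_lcancel cong_trans)

lemma shift_invariant_mult_nat:
  assumes "shift_invariant X m d"
  shows "shift_invariant X m (int n * d)"
proof (induction n)
  case 0
  show ?case by (auto simp: shift_invariant_def intro: cong_refl)
next
  case (Suc n)
  show ?case
    unfolding shift_invariant_def
  proof
    fix x assume "x \<in> X"
    then obtain y where y: "y \<in> X" "[y = x + int n * d] (mod m)"
      using Suc by (auto simp: shift_invariant_def)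
    then obtain w where w: "w \<in> X" "[w = y + d] (mod m)"
      using assms by (auto simp: shift_invariant_def)
    have "[y + d = x + int n * d + d] (mod m)" using y(2) by (simp add: cong_add_rcancel)
    then have "[w = x + int (Suc n) * d] (mod m)"
      using w(2) cong_trans by (fastforce simp: algebra_simps)
    with w(1) show "\<exists>y\<in>X. [y = x + int (Suc n) * d] (mod m)" by blast
  qed
qed

text \<open>
  Modulo \<open>m\<close> every integer multiple of \<open>d\<close> is a natural one, so no argument about the
  injectivity of the shift is needed.
\<close>

lemma shift_invariant_mult:
  assumes "shift_invariant X m d" "m > 0"
  shows "shift_invariant X m (u * d)"
proof -
  have "shift_invariant X m (int (nat (u mod m)) * d)"
    by (rule shift_invariant_mult_nat[OF assms(1)])
  moreover have "[int (nat (u mod m)) * d = u * d] (mod m)"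
    using assms(2) by (simp add: cong_def mod_mult_left_eq)
  ultimately show ?thesis by (rule shift_invariant_cong)
qed

lemma shift_invariant_gcd:
  assumes "shift_invariant X m d" "m > 0"
  shows "shift_invariant X m (gcd d m)"
proof -
  obtain u v where "u * d + v * m = gcd d m" using bezout_int by blast
  then have "[u * d = gcd d m] (mod m)"
    by (metis cong_iff_lin mult.commute)
  with shift_invariant_mult[OF assms, of u] show ?thesis by (rule shift_invariant_cong)
qed

lemma covers_if_shift_invariant:
  assumes "shift_invariant X (p * q) q" "covers X q" "p * q > 0"
  shows "covers X (p * q)"
  unfolding covers_def
proof
  fix r
  obtain x where x: "x \<in> X" "[x = r] (mod q)" using assms(2) by (auto simp: covers_def)
  then obtain u where u: "r = x + q * u" by (auto simp: cong_iff_lin)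
  have "shift_invariant X (p * q) (u * q)" by (rule shift_invariant_mult[OF assms(1,3)])
  with x(1) show "\<exists>x\<in>X. [x = r] (mod p * q)"
    unfolding shift_invariant_def u by (simp add: mult.commute)
qed

lemma covers_if_shift_invariant_coprime:
  assumes "shift_invariant X m d" "coprime d m" "m > 0" "X \<noteq> {}"
  shows "covers X m"
proof -
  have "shift_invariant X (m * 1) 1" using shift_invariant_gcd[OF assms(1,3)] assms(2) by simp
  moreover have "covers X 1" using assms(4) by (auto simp: covers_def)
  ultimately show ?thesis using covers_if_shift_invariant[of X m 1] assms(3) by simp
qed

text \<open>
  A nonzero shift generates all residues modulo a prime, so only the full set of residues is mapped
  into itself.
\<close>

lemma exists_unmatched_shift_prime:
  fixes q :: int
  assumes "prime q" "X \<noteq> {}" "\<not> covers X q" "\<not> q dvd d"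
  shows "\<exists>x\<in>X. \<forall>y\<in>X. \<not> [y = x + d] (mod q)"
proof (rule ccontr)
  assume "\<not> ?thesis"
  then have "shift_invariant X q d" by (auto simp: shift_invariant_def)
  moreover have "coprime d q" using assms(1,4) by (metis coprime_commute prime_imp_coprime)
  moreover have "q > 0" using assms(1) by (simp add: prime_gt_0_int)
  ultimately show False using assms(2,3) covers_if_shift_invariant_coprime by blast
qed

lemma residues_covers:
  assumes "covers X m" "m > 0"
  shows "(\<lambda>x. x mod m) ` X = {0..<m}"
proof
  show "{0..<m} \<subseteq> (\<lambda>x. x mod m) ` X"
  proof
    fix r assume r: "r \<in> {0..<m}"
    obtain x where "x \<in> X" "[x = r] (mod m)" using assms(1) by (auto simp: covers_def)
    with r show "r \<in> (\<lambda>x. x mod m) ` X" by (force simp: cong_def)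
  qed
qed (use assms(2) in auto)

lemma card_sumset_covers_ge:
  fixes X C :: "int set"
  assumes "finite X" "finite C" "C \<noteq> {}" "\<And>c. c \<in> C \<Longrightarrow> [c = b] (mod m)" "covers X m" "m > 0"
  shows "int (card X) + m * (int (card C) - 1) \<le> int (card (X + C))"
  using card_sumset_residue_class_ge[of X C b m] assms residues_covers[of X m] by simp

section \<open>Splitting a sum of dilates along residue classes\<close>

text \<open>
  The elements of \<open>A\<close> congruent to \<open>i\<close> modulo \<open>k\<close>, rescaled to have gap one.
\<close>

definition fibre :: "int \<Rightarrow> int set \<Rightarrow> int \<Rightarrow> int set"
  where "fibre k A i = {x. k * x + i \<in> A}"

lemma fibre_image:
  assumes "k > 0" "0 \<le> i" "i < k"
  shows "(\<lambda>x. i + k * x) ` fibre k A i = {a \<in> A. a mod k = i}"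
proof
  show "{a \<in> A. a mod k = i} \<subseteq> (\<lambda>x. i + k * x) ` fibre k A i"
  proof
    fix a assume a: "a \<in> {a \<in> A. a mod k = i}"
    then have "a = i + k * (a div k)" by (metis (mono_tags) mem_Collect_eq mod_mult_div_eq)
    with a show "a \<in> (\<lambda>x. i + k * x) ` fibre k A i"
      by (intro image_eqI[of _ _ "a div k"]) (auto simp: fibre_def add.commute)
  qed
qed (use assms in \<open>auto simp: fibre_def add.commute\<close>)

lemma card_fibre:
  assumes "k > 0" "0 \<le> i" "i < k"
  shows "card (fibre k A i) = card {a \<in> A. a mod k = i}"
  unfolding fibre_image[OF assms, symmetric]
  using assms(1) by (subst card_image) (auto intro!: inj_onI)

lemma finite_fibre:
  assumes "finite A" "k > 0"
  shows "finite (fibre k A i)"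
proof -
  have "(\<lambda>x. k * x + i) ` fibre k A i \<subseteq> A" by (auto simp: fibre_def)
  moreover have "inj_on (\<lambda>x. k * x + i) (fibre k A i)" using assms(2) by (auto intro!: inj_onI)
  ultimately show ?thesis using assms(1) by (meson finite_imageD finite_subset)
qed

lemma card_dilate_sumset_fibres:
  fixes A :: "int set"
  assumes A: "finite A" and k: "k > 0"
  shows "int (card (A + k *o A)) = (\<Sum>i\<in>(\<lambda>a. a mod k) ` A. int (card (fibre k A i + A)))"
proof -
  let ?U = "(\<lambda>a. a mod k) ` A" and ?F = "\<lambda>i. (\<lambda>y. i + k * y) ` (fibre k A i + A)"
  have eq: "A + k *o A = (\<Union>i\<in>?U. ?F i)"
  proof (intro equalityI subsetI)
    fix w assume "w \<in> A + k *o A"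
    then obtain a b where ab: "a \<in> A" "b \<in> A" "w = a + k * b"
      by (auto elim!: set_plus_elim simp: elt_set_times_def)
    have "a = a mod k + k * (a div k)" by simp
    then have "w = a mod k + k * (a div k + b)" "a div k \<in> fibre k A (a mod k)"
      using ab by (auto simp: fibre_def algebra_simps)
    with ab show "w \<in> (\<Union>i\<in>?U. ?F i)" by (blast intro: set_plus_intro)
  next
    fix w assume "w \<in> (\<Union>i\<in>?U. ?F i)"
    then obtain i x b where "x \<in> fibre k A i" "b \<in> A" "w = i + k * (x + b)"
      by (auto elim!: set_plus_elim)
    then have "k * x + i \<in> A" "k * b \<in> k *o A" "w = (k * x + i) + k * b"
      by (auto simp: fibre_def elt_set_times_def algebra_simps)
    then show "w \<in> A + k *o A" by blast
  qed
  have dis: "?F i \<inter> ?F j = {}" if "i \<in> ?U" "j \<in> ?U" "i \<noteq> j" for i j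
  proof (rule ccontr)
    assume "?F i \<inter> ?F j \<noteq> {}"
    then obtain y y' where "i + k * y = j + k * y'" by auto
    then have "i mod k = j mod k" by (metis mod_mult_self2)
    with that show False by auto
  qed
  have fin: "finite (?F i)" for i using finite_fibre[OF A k] A by (auto intro!: finite_sumset)
  have "card (A + k *o A) = (\<Sum>i\<in>?U. card (?F i))"
    unfolding eq using A fin dis by (intro card_UN_disjoint) auto
  also have "\<dots> = (\<Sum>i\<in>?U. card (fibre k A i + A))"
    using k by (intro sum.cong refl card_image) (auto intro!: inj_onI)
  finally show ?thesis by simp
qed

text \<open>
  The dilate \<open>k \<cdot> A\<close> lies in a single residue class modulo \<open>k\<close>.
\<close>

lemma card_dilate_sumset_residues_ge:
  fixes A :: "int set"
  assumes "finite A" "A \<noteq> {}" "k > 0"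
  shows "int (card A) + int (card ((\<lambda>a. a mod k) ` A)) * (int (card A) - 1) \<le> int (card (A + k *o A))"
proof -
  have eq: "k *o A = (\<lambda>a. k * a) ` A" by (auto simp: elt_set_times_def)
  have "card (k *o A) = card A" unfolding eq using assms(3) by (intro card_image) (auto intro!: inj_onI)
  moreover have "int (card A) + int (card ((\<lambda>a. a mod k) ` A)) * (int (card (k *o A)) - 1)
      \<le> int (card (A + k *o A))"
    using assms unfolding eq
    by (intro card_sumset_residue_class_ge[where b = 0]) (auto simp: cong_0_iff)
  ultimately show ?thesis by simp
qed

section \<open>Balancing surpluses and deficits\<close>

lemma sum_le_superset:
  fixes e :: "int \<Rightarrow> int"
  assumes "finite U" "T \<subseteq> U" "\<And>i. i \<in> U - T \<Longrightarrow> e i \<ge> 0"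
  shows "sum e T \<le> sum e U"
  using assms by (intro sum_mono2) auto

text \<open>
  The members of \<open>S\<close> together lack at most the sum of their sizes minus one copy of
  \<open>p * n m\<close> for each. The surplus of \<open>m\<close> is short of the sum over \<open>P\<close> by a single
  such copy, so one member of \<open>S\<close> suffices to make up for it.
\<close>

lemma deficits_covered_from_outside:
  fixes e n :: "int \<Rightarrow> int" and p :: int
  assumes fin: "finite P" and S: "S \<subseteq> P" "S \<noteq> {}" and npos: "\<And>i. i \<in> P \<Longrightarrow> 0 \<le> n i"
    and p: "0 \<le> p" and xpos: "0 \<le> n m" and m: "m \<notin> P"
    and eS: "\<And>i. i \<in> S \<Longrightarrow> p * n m - n i \<le> e i"
    and em: "p * n m \<le> sum n P \<Longrightarrow> sum n P - p * n m \<le> e m"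
    and big: "\<exists>i\<in>P. p * n m \<le> n i"
  shows "sum n P - sum n S \<le> sum e (insert m S)"
proof -
  have fS: "finite S" using S(1) fin by (rule finite_subset)
  obtain i where i: "i \<in> P" "p * n m \<le> n i" using big by blast
  have "n i \<le> sum n P" using fin npos i(1) by (intro member_le_sum) auto
  with i em have em': "sum n P - p * n m \<le> e m" by linarith
  have "sum e S \<ge> (\<Sum>i\<in>S. p * n m - n i)" by (intro sum_mono eS)
  also have "(\<Sum>i\<in>S. p * n m - n i) = int (card S) * (p * n m) - sum n S"
    by (simp add: sum_subtractf)
  finally have 1: "int (card S) * (p * n m) - sum n S \<le> sum e S" .
  have "int (card S) \<ge> 1" using fS S(2) by (simp add: Suc_leI card_gt_0_iff)
  moreover have "0 \<le> p * n m" using p xpos by simp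
  ultimately have "p * n m \<le> int (card S) * (p * n m)"
    by (metis mult_right_mono mult_1)
  moreover have "sum e (insert m S) = e m + sum e S"
    using fS S(1) m by (subst sum.insert) auto
  ultimately show ?thesis using em' 1 by linarith
qed

lemma sum_subset_le:
  fixes n :: "int \<Rightarrow> int"
  assumes "finite P" "S \<subseteq> P" "\<And>i. i \<in> P \<Longrightarrow> 0 \<le> n i"
  shows "sum n S \<le> sum n P"
  using assms by (intro sum_mono2) auto

text \<open>
  An abstract account of the surpluses \<open>e i\<close> of classes \<open>i\<close> of sizes \<open>n i\<close>, where
  \<open>r\<close> is a largest class and a negative surplus is called a deficit. In the application
  \<open>Pa\<close> and \<open>Pb\<close> are the classes congruent to \<open>r\<close> modulo either prime,
  \<open>Ba\<close> and \<open>Bb\<close> are the classes in them whose fibres are invariant under the shift by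
  that prime without meeting all residues modulo it, and \<open>ma\<close>, \<open>mb\<close> are largest classes outside \<open>Pa\<close> and
  \<open>Pb\<close>. Everything is symmetric in the two primes, which is exploited through
  \<open>swapped\<close>.
\<close>

locale surplus =
  fixes U :: "int set" and r :: int and n e :: "int \<Rightarrow> int"
    and Pa Pb Ba Bb :: "int set" and a b :: int and ma mb :: int
  assumes fin: "finite U" and r: "r \<in> U"
    and npos: "\<And>i. i \<in> U \<Longrightarrow> 0 < n i" and nmax: "\<And>i. i \<in> U \<Longrightarrow> n i \<le> n r"
    and P: "Pa \<subseteq> U" "Pb \<subseteq> U" "Pa \<inter> Pb = {r}"
    and B: "Ba \<subseteq> Pa" "Bb \<subseteq> Pb"
    and ab: "2 \<le> a" "2 \<le> b"
    and m: "ma \<in> U - Pa" "mb \<in> U - Pb"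
    and mmax: "\<And>i. i \<in> U - Pa \<Longrightarrow> n i \<le> n ma" "\<And>i. i \<in> U - Pb \<Longrightarrow> n i \<le> n mb"
    and eB: "\<And>i. i \<in> Ba \<Longrightarrow> a * n ma - n i \<le> e i" "\<And>i. i \<in> Bb \<Longrightarrow> b * n mb - n i \<le> e i"
    and em: "a * n ma \<le> sum n Pa \<Longrightarrow> sum n Pa - a * n ma \<le> e ma"
            "b * n mb \<le> sum n Pb \<Longrightarrow> sum n Pb - b * n mb \<le> e mb"
    and good: "\<And>i. i \<in> U - {r} - Ba - Bb \<Longrightarrow> n r - n i \<le> e i"
begin

lemma swapped: "surplus U r n e Pb Pa Bb Ba b a mb ma"
  using fin r npos nmax P B ab m mmax eB em good by unfold_locales auto

lemma r_in: "r \<in> Pa" "r \<in> Pb" using P by auto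

lemma finP: "finite Pa" "finite Pb" using finite_subset[OF P(1) fin] finite_subset[OF P(2) fin] .

text \<open>
  The class \<open>ma\<close> pays for all deficits in \<open>Ba\<close>: a deficit \<open>i\<close> forces
  \<open>a * n ma \<le> n i\<close>, which is what makes the surplus of \<open>ma\<close> large.
\<close>

lemma cover_nonneg:
  assumes ne: "{i\<in>Ba. e i < 0} \<noteq> {}"
  shows "0 \<le> sum e (insert ma {i\<in>Ba. e i < 0})"
proof -
  let ?S = "{i\<in>Ba. e i < 0}"
  obtain i where i: "i \<in> Ba" "e i < 0" using ne by blast
  then have "a * n ma \<le> n i" using eB(1)[of i] by linarith
  then have big: "\<exists>i\<in>Pa. a * n ma \<le> n i" using i B by blast
  have "0 \<le> sum n Pa - sum n ?S"
    using sum_subset_le[OF finP(1), of ?S n] B npos P by fastforce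
  also have "\<dots> \<le> sum e (insert ma ?S)"
  proof (rule deficits_covered_from_outside[where p = a and P = Pa and n = n and m = ma and e = e])
    show "a * n ma \<le> sum n Pa \<Longrightarrow> sum n Pa - a * n ma \<le> e ma" by (rule em(1))
    show "finite Pa" "?S \<noteq> {}" "\<exists>i\<in>Pa. a * n ma \<le> n i" by (fact finP(1) ne big)+
    show "0 \<le> a" using ab by linarith
    show "a * n ma - n i \<le> e i" if "i \<in> ?S" for i using that eB(1)[of i] by blast
    show "?S \<subseteq> Pa" using B by blast
    show "0 \<le> n i" if "i \<in> Pa" for i using that npos[of i] P(1) by auto
    show "0 \<le> n ma" using npos[of ma] m(1) by auto
    show "ma \<notin> Pa" using m(1) by blast
  qed
  finally show ?thesis .
qed

lemma sum_nonneg_if_deficits_in_Ba: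
  assumes neg: "\<And>i. i \<in> U \<Longrightarrow> e i < 0 \<Longrightarrow> i \<in> Ba"
  shows "0 \<le> sum e U"
proof (cases "\<exists>i\<in>Ba. e i < 0")
  case False
  then show ?thesis using neg by (intro sum_nonneg) force
next
  case True
  let ?S = "{i\<in>Ba. e i < 0}"
  have "0 \<le> sum e (insert ma ?S)" using True by (intro cover_nonneg) blast
  also have "\<dots> \<le> sum e U"
  proof (intro sum_le_superset fin)
    show "insert ma ?S \<subseteq> U" using m B P by blast
    show "0 \<le> e i" if "i \<in> U - insert ma ?S" for i using that neg[of i] by force
  qed
  finally show ?thesis .
qed

lemma ma_no_deficit:
  assumes "i \<in> Ba" "e i < 0"
  shows "0 \<le> e ma"
proof -
  have "a * n ma \<le> n i" using eB(1)[OF assms(1)] assms(2) by linarith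
  also have "n i \<le> sum n Pa"
    using assms(1) B P npos by (intro member_le_sum finP) (auto intro!: less_imp_le)
  finally show ?thesis using em(1) by linarith
qed

lemma deficit_gt_ma:
  assumes "i \<in> Ba" "e i < 0"
  shows "n ma < n i"
proof -
  have "a * n ma < n i" using eB(1)[OF assms(1)] assms(2) by linarith
  moreover have "n ma \<le> a * n ma" using ab npos m by simp
  ultimately show ?thesis by linarith
qed

text \<open>
  Apart from \<open>r\<close>, the set \<open>Pa\<close> lies outside \<open>Pb\<close>.
\<close>

lemma le_mb_outside_Pb:
  assumes "i \<in> Ba" "i \<noteq> r" shows "n i \<le> n mb"
  using assms B P mmax(2) by blast

text \<open>
  The deficit of \<open>r\<close> is paid by \<open>ma\<close> and those in \<open>Bb\<close> by \<open>mb\<close>. The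
  two payers differ: a deficit \<open>i\<close> in \<open>Bb\<close> other than \<open>r\<close> is larger than
  \<open>mb\<close> but at most \<open>ma\<close>.
\<close>

lemma sum_nonneg_if_at_most_r_in_Ba:
  assumes neg: "\<And>i. i \<in> U \<Longrightarrow> e i < 0 \<Longrightarrow> i \<in> Ba \<union> Bb"
    and only: "\<And>i. i \<in> Ba \<Longrightarrow> e i < 0 \<Longrightarrow> i = r"
  shows "0 \<le> sum e U"
proof -
  interpret sw: surplus U r n e Pb Pa Bb Ba b a mb ma by (rule swapped)
  show ?thesis
  proof (cases "r \<in> Ba \<and> e r < 0 \<and> r \<notin> Bb")
    case False
    then have "i \<in> Bb" if "i \<in> U" "e i < 0" for i using that neg only by blast
    then show ?thesis by (rule sw.sum_nonneg_if_deficits_in_Ba)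
  next
    case True
    let ?S = "{i\<in>Bb. e i < 0}"
    show ?thesis
    proof (cases "?S = {}")
      case True
      then show ?thesis using neg by (intro sum_nonneg_if_deficits_in_Ba) blast
    next
      case False
      then obtain i where i: "i \<in> Bb" "e i < 0" by blast
      have mm: "ma \<noteq> mb" 
      proof
        assume eq: "ma = mb"
        have "i \<noteq> r" using i(1) \<open>r \<in> Ba \<and> e r < 0 \<and> r \<notin> Bb\<close> by auto
        then show False using sw.deficit_gt_ma[OF i] sw.le_mb_outside_Pb[OF i(1)] eq by auto
      qed
      have "{i\<in>Ba. e i < 0} = {r}"
        using only \<open>r \<in> Ba \<and> e r < 0 \<and> r \<notin> Bb\<close> by blast
      then have 1: "0 \<le> sum e {ma, r}" using cover_nonneg by simp
      have 2: "0 \<le> sum e (insert mb ?S)" using False by (rule sw.cover_nonneg)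
      have "finite ?S" using finite_subset[OF _ finP(2), of ?S] B by blast
      moreover have "{ma, r} \<inter> insert mb ?S = {}"
        using mm \<open>r \<in> Ba \<and> e r < 0 \<and> r \<notin> Bb\<close> ma_no_deficit[of r] m r_in by auto
      ultimately have "sum e ({ma, r} \<union> insert mb ?S) = sum e {ma, r} + sum e (insert mb ?S)"
        by (intro sum.union_disjoint) auto
      moreover have "sum e ({ma, r} \<union> insert mb ?S) \<le> sum e U"
      proof (intro sum_le_superset fin)
        show "{ma, r} \<union> insert mb ?S \<subseteq> U" using m B P r by auto
        fix i assume i: "i \<in> U - ({ma, r} \<union> insert mb ?S)"
        show "0 \<le> e i"
        proof (rule ccontr)
          assume "\<not> 0 \<le> e i"
          with i neg[of i] only[of i] show False by auto
        qed
      qed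
      ultimately show ?thesis using 1 2 by linarith
    qed
  qed
qed

text \<open>
  Deficits other than \<open>r\<close> cannot occur on both sides: one in \<open>Ba\<close> is larger than
  \<open>ma\<close> and at most \<open>mb\<close>, and one in \<open>Bb\<close> the reverse.
\<close>

lemma sum_nonneg_if_r_regular:
  assumes one: "r \<in> Ba \<union> Bb \<or> 0 \<le> e r"
  shows "0 \<le> sum e U"
proof -
  interpret sw: surplus U r n e Pb Pa Bb Ba b a mb ma by (rule swapped)
  have neg: "i \<in> Ba \<union> Bb" if "i \<in> U" "e i < 0" for i
  proof (rule ccontr)
    assume c: "i \<notin> Ba \<union> Bb"
    then have "i \<noteq> r" using one that(2) by (metis linorder_not_less)
    then have "i \<in> U - {r} - Ba - Bb" using c that(1) by blast
    from good[OF this] nmax[OF that(1)] that(2) show False by linarith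
  qed
  show ?thesis
  proof (cases "\<exists>i\<in>Ba. e i < 0 \<and> i \<noteq> r")
    case False
    then show ?thesis using neg by (intro sum_nonneg_if_at_most_r_in_Ba) auto
  next
    case True
    then obtain i where i: "i \<in> Ba" "e i < 0" "i \<noteq> r" by blast
    have "j = r" if j: "j \<in> Bb" "e j < 0" for j
    proof (rule ccontr)
      assume "j \<noteq> r"
      then show False
        using deficit_gt_ma[OF i(1,2)] sw.deficit_gt_ma[OF j] le_mb_outside_Pb[OF i(1,3)] sw.le_mb_outside_Pb[OF j(1)]
        by linarith
    qed
    then show ?thesis using neg by (intro sw.sum_nonneg_if_at_most_r_in_Ba) auto
  qed
qed

text \<open>
  Here \<open>r\<close> may lack its difference to the second largest class \<open>s\<close>. If \<open>ma\<close>
  has its large surplus, it pays for \<open>s\<close>, \<open>r\<close> and the remaining deficits of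
  \<open>Ba\<close> together, all of which lie in \<open>Pa\<close>. Otherwise \<open>a * n ma\<close> exceeds
  the sum over \<open>Pa\<close>, so that \<open>s\<close> alone has a surplus larger than \<open>n r\<close>.
\<close>

lemma sum_nonneg_if_second_in_Ba:
  assumes eo: "\<And>l. l \<in> U - {r} \<Longrightarrow> n l - n r \<le> e r" and oB: "r \<notin> Ba \<union> Bb"
    and s: "s \<in> Ba" "\<And>i. i \<in> U - {r} \<Longrightarrow> n i \<le> n s"
  shows "0 \<le> sum e U"
proof -
  interpret sw: surplus U r n e Pb Pa Bb Ba b a mb ma by (rule swapped)
  have so: "s \<noteq> r" using s oB by auto
  have sU: "s \<in> U" "s \<in> Pa" using s B P by auto
  have "s \<notin> Pb" using so sU P by auto
  with sU have nmb: "n s \<le> n mb" using mmax(2) by blast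
  have neg: "i = r \<or> i \<in> Ba" if "i \<in> U" "e i < 0" for i
  proof (rule ccontr)
    assume c: "\<not> ?thesis"
    show False
    proof (cases "i \<in> Bb")
      case True
      from sw.deficit_gt_ma[OF this that(2)] nmb s(2)[of i] that c show False by auto
    next
      case False
      with good[of i] nmax[of i] that c show False by auto
    qed
  qed
  have mao: "ma \<noteq> r" "ma \<notin> Pa" "ma \<in> U" using m r_in by auto
  show ?thesis
  proof (cases "a * n ma \<le> sum n Pa")
    case True
    let ?S = "insert s {i\<in>Ba. e i < 0}"
    have S: "?S \<subseteq> Pa" "r \<notin> ?S" using s B oB by auto
    note S = S finite_subset[OF S(1) finP(1)]
    have eS: "sum e ?S \<ge> int (card ?S) * (a * n ma) - sum n ?S"
    proof -
      have "sum e ?S \<ge> (\<Sum>i\<in>?S. a * n ma - n i)" using s eB by (intro sum_mono) auto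
      then show ?thesis by (simp add: sum_subtractf)
    qed
    have "int (card ?S) \<ge> 1" using S(3) by (simp add: Suc_leI card_gt_0_iff)
    moreover have "0 \<le> a * n ma" using ab npos[of ma] mao by simp
    ultimately have "a * n ma \<le> int (card ?S) * (a * n ma)"
      by (metis mult_right_mono mult_1)
    moreover have "sum n (insert r ?S) \<le> sum n Pa"
      using S r_in npos P by (intro sum_subset_le finP) (auto intro!: less_imp_le)
    moreover have "sum n (insert r ?S) = n r + sum n ?S" using S by (subst sum.insert) auto
    moreover have "sum e (insert ma (insert r ?S)) = e ma + (e r + sum e ?S)"
      using S mao by (subst sum.insert; (subst sum.insert)?) auto
    moreover have "sum e (insert ma (insert r ?S)) \<le> sum e U"
    proof (intro sum_le_superset fin)
      show "insert ma (insert r ?S) \<subseteq> U" using mao r S P by auto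
      fix i assume "i \<in> U - insert ma (insert r ?S)"
      then show "0 \<le> e i" using neg[of i] by force
    qed
    ultimately show ?thesis using eS em(1)[OF True] eo[of s] sU so npos[OF sU(1)] by auto
  next
    case False
    have nn: "n i \<le> sum n Pa" if "i \<in> Pa" for i
      using that npos P by (intro member_le_sum finP) (auto intro!: less_imp_le)
    have "0 \<le> e i" if "i \<in> U - {s, r}" for i
    proof (rule ccontr)
      assume c: "\<not> 0 \<le> e i"
      with neg[of i] that have "i \<in> Ba" by auto
      with nn[of i] eB(1)[of i] False B c show False by auto
    qed
    then have "sum e {s, r} \<le> sum e U" using sU r by (intro sum_le_superset fin) auto
    moreover have "sum n {s, r} \<le> sum n Pa"
      using sU r_in npos P by (intro sum_subset_le finP) (auto intro!: less_imp_le)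
    ultimately show ?thesis
      using so eB(1)[OF s(1)] eo[of s] sU False npos[OF sU(1)] by auto
  qed
qed

text \<open>
  The second largest class \<open>s\<close> pays for \<open>r\<close>. Since \<open>s\<close> lies outside
  \<open>Pa\<close>, \<open>ma\<close> is as large as \<open>s\<close> and \<open>Ba\<close> has no deficit; the deficits
  of \<open>Bb\<close> are larger than \<open>mb\<close> and at most \<open>s\<close>, so that their payer
  \<open>mb\<close> is not \<open>s\<close>.
\<close>

lemma sum_nonneg_if_second_regular:
  assumes eo: "\<And>l. l \<in> U - {r} \<Longrightarrow> n l - n r \<le> e r" and oB: "r \<notin> Ba \<union> Bb"
    and s: "s \<in> U - {r}" "s \<notin> Ba \<union> Bb" "s \<notin> Pa" "\<And>i. i \<in> U - {r} \<Longrightarrow> n i \<le> n s"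
  shows "0 \<le> sum e U"
proof -
  interpret sw: surplus U r n e Pb Pa Bb Ba b a mb ma by (rule swapped)
  let ?S = "{i\<in>Bb. e i < 0}" and ?T = "{r, s}"
  have "n s \<le> n ma" using s mmax(1) by blast
  have nBa: "0 \<le> e i" if "i \<in> Ba" for i
  proof (rule ccontr)
    assume "\<not> 0 \<le> e i"
    moreover have "i \<in> U - {r}" using that oB B P by auto
    ultimately show False using deficit_gt_ma[OF that] s(4)[of i] \<open>n s \<le> n ma\<close> by auto
  qed
  have neg: "i = r \<or> i \<in> ?S" if "i \<in> U" "e i < 0" for i
    using nBa[of i] good[of i] nmax[of i] that by force
  have es: "0 \<le> sum e ?T" using good[of s] s eo[of s] by auto
  show ?thesis
  proof (cases "?S = {}")
    case True
    have "sum e ?T \<le> sum e U"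
    proof (intro sum_le_superset fin)
      show "?T \<subseteq> U" using r s by auto
      show "0 \<le> e i" if "i \<in> U - ?T" for i
      proof (rule ccontr)
        assume "\<not> 0 \<le> e i"
        then show False using neg[of i] that True by auto
      qed
    qed
    with es show ?thesis by linarith
  next
    case False
    then obtain i where i: "i \<in> Bb" "e i < 0" by blast
    have "i \<in> U - {r}" using i(1) oB B P by auto
    then have "mb \<noteq> s" using sw.deficit_gt_ma[OF i] s(4)[of i] by auto
    then have dis: "?T \<inter> insert mb ?S = {}" using m r_in oB s by auto
    have "finite ?S" using finite_subset[OF _ finP(2), of ?S] B by blast
    then have "sum e (?T \<union> insert mb ?S) = sum e ?T + sum e (insert mb ?S)"
      using dis by (intro sum.union_disjoint) auto
    moreover have "0 \<le> sum e (insert mb ?S)" using False by (rule sw.cover_nonneg)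
    moreover have "sum e (?T \<union> insert mb ?S) \<le> sum e U"
    proof (intro sum_le_superset fin)
      show "?T \<union> insert mb ?S \<subseteq> U" using m B P r s by auto
      fix i assume "i \<in> U - (?T \<union> insert mb ?S)"
      then show "0 \<le> e i" using neg[of i] by (metis DiffE Un_iff insertCI linorder_not_less)
    qed
    ultimately show ?thesis using es by linarith
  qed
qed

text \<open>
  The class \<open>r\<close> either is treated like the others, or may lack its difference to each other
  class; in the latter case the second largest class decides.
\<close>

lemma sum_surplus_nonneg:
  assumes one: "r \<in> Ba \<union> Bb \<or> 0 \<le> e r \<or> (\<forall>l\<in>U - {r}. n l - n r \<le> e r)"
  shows "0 \<le> sum e U"
proof (cases "r \<in> Ba \<union> Bb \<or> 0 \<le> e r")
  case True
  then show ?thesis by (rule sum_nonneg_if_r_regular)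
next
  case False
  interpret sw: surplus U r n e Pb Pa Bb Ba b a mb ma by (rule swapped)
  have eo: "n l - n r \<le> e r" if "l \<in> U - {r}" for l using False one that by blast
  have "ma \<in> U - {r}" using m r_in by auto
  then have "Max (n ` (U - {r})) \<in> n ` (U - {r})" using fin by (intro Max_in) auto
  then obtain s where s: "s \<in> U - {r}" "n s = Max (n ` (U - {r}))" by (metis imageE)
  have smax: "n i \<le> n s" if "i \<in> U - {r}" for i using that fin s(2) by auto
  show ?thesis
  proof (cases "s \<in> Ba \<union> Bb")
    case True
    then show ?thesis using sum_nonneg_if_second_in_Ba[of s] sw.sum_nonneg_if_second_in_Ba[of s] eo smax False by auto
  next
    case sgood: False
    have "s \<notin> Pa \<or> s \<notin> Pb" using s P by auto
    then show ?thesis using sum_nonneg_if_second_regular[of s] sw.sum_nonneg_if_second_regular[of s] sgood s eo smax False by auto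
  qed
qed

end

section \<open>Excess of a residue class for a product of two primes\<close>

lemma obtain_argmax:
  fixes g :: "'a \<Rightarrow> int"
  assumes "finite S" "S \<noteq> {}"
  obtains m where "m \<in> S" "\<And>i. i \<in> S \<Longrightarrow> g i \<le> g m"
proof -
  have "Max (g ` S) \<in> g ` S" using assms by (intro Max_in) auto
  then obtain m where "m \<in> S" "g m = Max (g ` S)" by (metis imageE)
  then show ?thesis using that assms by (metis Max_ge finite_imageI imageI)
qed

text \<open>
  The inductive bound with slope \<open>t\<close> and constant \<open>c\<close> is assumed for all sets, so that it
  can be applied to the fibres of \<open>A\<close>.
\<close>

locale residue_classes =
  fixes p1 p2 k t c :: int and A :: "int set"
  assumes p1: "prime p1" and p2: "prime p2" and p12: "p1 \<noteq> p2" and k: "k = p1 * p2"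
    and finA: "finite A"
    and nonconst1: "\<And>r. \<exists>a\<in>A. \<not> [a = r] (mod p1)"
    and nonconst2: "\<And>r. \<exists>a\<in>A. \<not> [a = r] (mod p2)"
    and weak: "\<And>X. finite X \<Longrightarrow> X \<noteq> {} \<Longrightarrow> t * int (card X) - c \<le> int (card (X + k *o X))"
    and c: "k \<le> c"
begin

definition U where "U = (\<lambda>a. a mod k) ` A"
definition X where "X i = fibre k A i"
definition n where "n i = int (card (X i))"
text \<open>
  How much the class \<open>i\<close> contributes beyond what the inductive bound gives for its own fibre.
\<close>

definition f where "f i = int (card (X i + A)) - t * n i + c"
definition stab where "stab i q \<longleftrightarrow> shift_invariant (X i) k q \<and> \<not> covers (X i) q"

lemma swapped: "residue_classes p2 p1 k t c A"
  using p1 p2 p12 k finA nonconst1 nonconst2 weak c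
  by unfold_locales (auto simp: mult.commute)

lemma kpos: "k > 0" using p1 p2 k by (simp add: prime_gt_0_int)

lemma finU: "finite U" using finA by (simp add: U_def)

lemma U_bounds: "i \<in> U \<Longrightarrow> 0 \<le> i" "i \<in> U \<Longrightarrow> i < k"
  using kpos by (auto simp: U_def)

lemma finX: "finite (X i)" using finite_fibre[OF finA kpos] by (simp add: X_def)

lemma X_image: "i \<in> U \<Longrightarrow> (\<lambda>x. i + k * x) ` X i = {a \<in> A. a mod k = i}"
  using fibre_image[OF kpos] U_bounds by (simp add: X_def)

lemma X_nonempty: "i \<in> U \<Longrightarrow> X i \<noteq> {}"
  using X_image[of i] by (auto simp: U_def)

lemma n_pos: "i \<in> U \<Longrightarrow> 0 < n i"
  using X_nonempty finX by (simp add: n_def card_gt_0_iff)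

lemma n_class: "i \<in> U \<Longrightarrow> n i = int (card {a \<in> A. a mod k = i})"
  using card_fibre[OF kpos] U_bounds by (simp add: X_def n_def)

lemma sum_n: "sum n U = int (card A)"
  using sum_card_mod_classes[OF finA, of k] n_class by (simp add: U_def)

lemma card_dilate: "int (card (A + k *o A)) = (\<Sum>i\<in>U. int (card (X i + A)))"
  using card_dilate_sumset_fibres[OF finA kpos] by (simp add: U_def X_def)

lemma cong_class:
  assumes "q dvd k" "a mod k = i"
  shows "[a = i] (mod q)"
  using assms by (metis cong_mod_left cong_refl cong_dvd_modulus)

lemma card_class_mod:
  assumes "q dvd k"
  shows "int (card {a\<in>A. [a = r] (mod q)}) = (\<Sum>i\<in>{i\<in>U. [i = r] (mod q)}. n i)"
proof -
  let ?C = "{a\<in>A. [a = r] (mod q)}"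
  have eq: "[a = r] (mod q) \<longleftrightarrow> [a mod k = r] (mod q)" for a
    using cong_class[OF assms refl, of a] by (meson cong_sym cong_trans)
  have im: "(\<lambda>x. x mod k) ` ?C = {i\<in>U. [i = r] (mod q)}"
    using eq by (auto simp: U_def)
  have "{x\<in>?C. x mod k = i} = {a\<in>A. a mod k = i}" if "i \<in> {i\<in>U. [i = r] (mod q)}" for i
    using that eq by auto
  then have "(\<Sum>i\<in>{i\<in>U. [i = r] (mod q)}. int (card {x\<in>?C. x mod k = i}))
      = (\<Sum>i\<in>{i\<in>U. [i = r] (mod q)}. n i)"
    using n_class by (intro sum.cong refl) auto
  then show ?thesis
    using finA by (subst sum_card_mod_classes[of _ k]) (auto simp: im)
qed

text \<open>
  The inductive bound for the fibre accounts for the sums with the own class, hence anything disjoint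
  from those sums is excess.
\<close>

lemma f_gain:
  assumes "i \<in> U" "Y \<subseteq> X i" "C \<subseteq> A" "(Y + C) \<inter> (X i + {a \<in> A. a mod k = i}) = {}"
  shows "int (card (Y + C)) \<le> f i"
proof -
  have "{a \<in> A. a mod k = i} = ((+) i) ` (k *o X i)"
    unfolding X_image[OF assms(1), symmetric] by (auto simp: elt_set_times_def)
  then have "card (X i + {a \<in> A. a mod k = i}) = card (X i + k *o X i)"
    by (simp add: card_translate_sumset)
  moreover have "t * n i - c \<le> int (card (X i + k *o X i))"
    unfolding n_def by (rule weak[OF finX X_nonempty[OF assms(1)]])
  moreover have "int (card (X i + {a \<in> A. a mod k = i})) + int (card (Y + C)) \<le> int (card (X i + A))"
    using assms by (intro card_sumset_gain finX finA) auto
  ultimately show ?thesis by (simp add: f_def)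
qed

lemma f_nonneg:
  assumes "i \<in> U"
  shows "0 \<le> f i"
  using f_gain[OF assms, of "{}" "{}"] by (simp add: set_plus_def)

lemma f_full:
  assumes i: "i \<in> U" "l \<in> U" and cov: "covers (X i) k"
  shows "k * n l - (t - 1) * n i \<le> f i"
proof -
  have "int (card (X i)) + k * (int (card {a \<in> A. a mod k = l}) - 1)
      \<le> int (card (X i + {a \<in> A. a mod k = l}))"
  proof (rule card_sumset_covers_ge[OF finX _ _ _ cov kpos])
    show "{a \<in> A. a mod k = l} \<noteq> {}" using i(2) by (auto simp: U_def)
    show "[a = l] (mod k)" if "a \<in> {a \<in> A. a mod k = l}" for a
      using that by (intro cong_class) auto
  qed (use finA in simp)
  also have "\<dots> \<le> int (card (X i + A))"
    using finA finX by (intro of_nat_mono card_mono finite_sumset set_plus_mono2) auto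
  finally show ?thesis using c n_class[OF i(2)] by (simp add: f_def n_def algebra_simps)
qed

lemma f_single:
  assumes i: "i \<in> U" "l \<in> U" and x: "x \<in> X i" "\<And>y. y \<in> X i \<Longrightarrow> \<not> [y = x + (l - i)] (mod k)"
  shows "n l \<le> f i"
proof -
  have "({x} + {a \<in> A. a mod k = l}) \<inter> (X i + {a \<in> A. a mod k = i}) = {}"
  proof (rule ccontr)
    assume "\<not> ?thesis"
    then obtain a y b where h: "a mod k = l" "b mod k = i" "y \<in> X i" "x + a = y + b"
      by (auto elim!: set_plus_elim)
    have ab: "[a = l] (mod k)" "[b = i] (mod k)" using h by (auto intro: cong_class)
    have "y = x + (a - b)" using h(4) by linarith
    then have "[y = x + (l - i)] (mod k)" using ab by (auto intro!: cong_add cong_diff)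
    with x(2) h(3) show False by blast
  qed
  then have "int (card ({x} + {a \<in> A. a mod k = l})) \<le> f i"
    using i x(1) by (intro f_gain) auto
  also have "{x} + {a \<in> A. a mod k = l} = ((+) x) ` {a \<in> A. a mod k = l}"
    by (auto simp: set_plus_def)
  finally show ?thesis using n_class[OF i(2)] by (simp add: card_image)
qed

text \<open>
  The shift by \<open>l - i\<close> moves some residue of the fibre modulo \<open>q\<close> to a new one. By
  invariance the fibre contains all \<open>p\<close> lifts of that residue modulo \<open>k\<close>, and each of
  them gives a separate new translate of the class \<open>l\<close>.
\<close>

lemma f_stab:
  assumes pq: "prime q" "k = p * q" and i: "i \<in> U" "l \<in> U"
    and st: "stab i q" and nc: "\<not> [l = i] (mod q)"
  shows "p * n l \<le> f i"
proof -
  have q: "q > 0" using pq by (simp add: prime_gt_0_int)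
  have p: "p > 0" using q kpos pq(2) by (simp add: zero_less_mult_iff)
  have inv: "shift_invariant (X i) k q" and ncov: "\<not> covers (X i) q" using st by (auto simp: stab_def)
  have "\<not> q dvd l - i" using nc by (simp add: cong_iff_dvd_diff)
  then obtain x where x: "x \<in> X i" "\<And>y. y \<in> X i \<Longrightarrow> \<not> [y = x + (l - i)] (mod q)"
    using exists_unmatched_shift_prime[OF pq(1) X_nonempty[OF i(1)] ncov] by blast
  (* The part of the fibre over the moved residue meets at least p classes modulo k. *)
  let ?Y = "{y \<in> X i. [y = x] (mod q)}" and ?C = "{a \<in> A. a mod k = l}"
  have qk: "q dvd k" using pq by simp
  have dis: "(?Y + ?C) \<inter> (X i + {a \<in> A. a mod k = i}) = {}"
  proof (rule ccontr)
    assume "\<not> ?thesis"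
    then obtain w a y b where h: "a mod k = l" "b mod k = i" "y \<in> X i" "w + a = y + b" "[w = x] (mod q)"
      by (auto elim!: set_plus_elim)
    have ab: "[a = l] (mod q)" "[b = i] (mod q)" using h qk by (auto intro: cong_class)
    have "y = w + (a - b)" using h(4) by linarith
    then have "[y = x + (l - i)] (mod q)" using ab h(5) by (auto intro!: cong_add cong_diff)
    with x(2) h(3) show False by blast
  qed
  have C: "?C \<noteq> {}" using i(2) by (auto simp: U_def)
  have res: "(\<lambda>h. (x + h * q) mod k) ` {0..<p} \<subseteq> (\<lambda>y. y mod k) ` ?Y"
  proof clarify
    fix h
    have "shift_invariant (X i) k (h * q)" by (rule shift_invariant_mult[OF inv kpos])
    then obtain y where y: "y \<in> X i" "[y = x + h * q] (mod k)"
      using x(1) by (auto simp: shift_invariant_def)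
    then have "[y = x + h * q] (mod q)" using qk cong_dvd_modulus by blast
    then have "[y = x] (mod q)" by (simp add: cong_def)
    with y show "(x + h * q) mod k \<in> (\<lambda>y. y mod k) ` ?Y"
      by (intro image_eqI[of _ _ y]) (simp_all add: cong_def)
  qed
  have "inj_on (\<lambda>h. (x + h * q) mod k) {0..<p}"
  proof (rule inj_onI)
    fix g h assume gh: "g \<in> {0..<p}" "h \<in> {0..<p}" "(x + g * q) mod k = (x + h * q) mod k"
    then have "k dvd (x + g * q) - (x + h * q)" by (simp add: mod_eq_dvd_iff)
    then have "p * q dvd (g - h) * q" using pq(2) by (simp add: algebra_simps)
    then have "p dvd g - h" using q by simp
    with gh show "g = h" by (metis atLeastLessThan_iff mod_eq_dvd_iff mod_pos_pos_trivial)
  qed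
  then have "int (card ((\<lambda>h. (x + h * q) mod k) ` {0..<p})) = p" using p by (simp add: card_image)
  moreover have "card ((\<lambda>h. (x + h * q) mod k) ` {0..<p}) \<le> card ((\<lambda>y. y mod k) ` ?Y)"
    using finX by (intro card_mono res) auto
  ultimately have pY: "p \<le> int (card ((\<lambda>y. y mod k) ` ?Y))" by linarith
  have "int (card ((\<lambda>y. y mod k) ` ?Y)) \<le> int (card ?Y)"
    using finX by (intro of_nat_mono card_image_le) auto
  moreover have "int (card ?Y) + int (card ((\<lambda>y. y mod k) ` ?Y)) * (int (card ?C) - 1)
      \<le> int (card (?Y + ?C))"
    using finX finA C by (intro card_sumset_residue_class_ge[where b = l]) (auto intro: cong_class)
  moreover have "int (card (?Y + ?C)) \<le> f i"
    using i(1) dis by (intro f_gain) auto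
  moreover have "p * n l \<le> int (card ((\<lambda>y. y mod k) ` ?Y)) * n l"
    using pY n_pos[OF i(2)] by (intro mult_right_mono) auto
  ultimately show ?thesis
    using n_class[OF i(2)] by (simp add: algebra_simps)
qed

text \<open>
  All classes congruent to \<open>r\<close> modulo \<open>q\<close> are used at once: they form one residue class
  modulo \<open>q\<close>, of size \<open>N\<close>. Either the fibre misses a residue modulo \<open>q\<close>, and some
  translate of this residue class is new, or it meets all \<open>q\<close> of them, and every residue yields
  about \<open>N\<close> sums.
\<close>

lemma f_outside:
  assumes pq: "prime q" "k = p * q" and i: "i \<in> U" and nc: "\<not> [i = r] (mod q)"
    and r: "r \<in> U"
  defines "N \<equiv> \<Sum>l\<in>{l\<in>U. [l = r] (mod q)}. n l"
  shows "N \<le> f i \<or> q * N - (t - 1) * n i \<le> f i"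
proof -
  have q: "q > 0" using pq by (simp add: prime_gt_0_int)
  have qk: "q dvd k" using pq by simp
  have ri: "\<not> q dvd r - i" using nc by (metis cong_iff_dvd_diff cong_sym)
  let ?C = "{a\<in>A. [a = r] (mod q)}"
  have N: "N = int (card ?C)" unfolding N_def by (rule card_class_mod[OF qk, symmetric])
  have "[r = r] (mod q)" by simp
  obtain a where a: "a \<in> A" "a mod k = r" using r by (auto simp: U_def)
  then have C: "?C \<noteq> {}" using cong_class[OF qk a(2)] by auto
  show ?thesis
  proof (cases "covers (X i) q")
    case True
    have "int (card (X i)) + q * (int (card ?C) - 1) \<le> int (card (X i + ?C))"
      using finA C q by (intro card_sumset_covers_ge[OF finX _ _ _ True]) auto
    also have "\<dots> \<le> int (card (X i + A))"
      using finA finX by (intro of_nat_mono card_mono finite_sumset set_plus_mono2) auto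
    finally have "q * N - (t - 1) * n i \<le> f i + (q - c)"
      using N by (simp add: f_def n_def algebra_simps)
    moreover have "q \<le> c" using c qk kpos zdvd_imp_le[of q k] by linarith
    ultimately show ?thesis by linarith
  next
    case False
    then obtain x where x: "x \<in> X i" "\<And>y. y \<in> X i \<Longrightarrow> \<not> [y = x + (r - i)] (mod q)"
      using exists_unmatched_shift_prime[OF pq(1) X_nonempty[OF i] _ ri] by blast
    have "({x} + ?C) \<inter> (X i + {a \<in> A. a mod k = i}) = {}"
    proof (rule ccontr)
      assume "\<not> ?thesis"
      then obtain a y b where h: "[a = r] (mod q)" "b mod k = i" "y \<in> X i" "x + a = y + b"
        by (auto elim!: set_plus_elim)
      have ab: "[b = i] (mod q)" using h qk by (auto intro: cong_class)
      have "y = x + (a - b)" using h(4) by linarith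
      then have "[y = x + (r - i)] (mod q)" using ab h(1) by (auto intro!: cong_add cong_diff)
      with x(2) h(3) show False by blast
    qed
    then have "int (card ({x} + ?C)) \<le> f i"
      using i x(1) by (intro f_gain) auto
    also have "{x} + ?C = ((+) x) ` ?C" by (auto simp: set_plus_def)
    finally show ?thesis using N by (simp add: card_image)
  qed
qed

lemma stab_if_divides:
  assumes inv: "shift_invariant (X i) k d" and ncov: "\<not> covers (X i) k"
    and d: "p1 dvd d" "\<not> p2 dvd d"
  shows "stab i p1"
proof -
  obtain w where w: "d = p1 * w" using d(1) by blast
  have "\<not> p2 dvd w" using d(2) w by auto
  then have "coprime w p2" using p2 by (metis coprime_commute prime_imp_coprime)
  then have "gcd d k = p1" using w k p1 by (simp add: gcd_mult_left prime_ge_0_int)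
  then have s: "shift_invariant (X i) k p1" using shift_invariant_gcd[OF inv kpos] by simp
  then have "\<not> covers (X i) p1"
    using covers_if_shift_invariant[of "X i" p2 p1] ncov kpos k by (auto simp: mult.commute)
  with s show ?thesis by (simp add: stab_def)
qed

text \<open>
  If the shift by \<open>l - i\<close> keeps the residues of a fibre modulo \<open>k\<close>, so does the greatest
  common divisor of \<open>l - i\<close> and \<open>k\<close>. If this is \<open>1\<close>, the fibre is full; otherwise it
  is one of the two primes, because \<open>l\<close> and \<open>i\<close> differ modulo \<open>k\<close>.
\<close>

lemma trichotomy:
  assumes i: "i \<in> U" "l \<in> U" "l \<noteq> i"
  shows "covers (X i) k \<or> n l \<le> f i \<or> (stab i p1 \<and> [i = l] (mod p1)) \<or> (stab i p2 \<and> [i = l] (mod p2))"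
proof (rule ccontr)
  interpret sw: residue_classes p2 p1 k t c A by (rule swapped)
  assume n: "\<not> ?thesis"
  have inv: "shift_invariant (X i) k (l - i)"
    using f_single[OF i(1,2)] n unfolding shift_invariant_def by blast
  have ncov: "\<not> covers (X i) k" using n by blast
  have "\<not> k dvd l - i"
    using U_bounds[OF i(1)] U_bounds[OF i(2)] i(3)
    by (metis mod_eq_dvd_iff mod_pos_pos_trivial)
  then have nb: "\<not> (p1 dvd l - i \<and> p2 dvd l - i)"
    using p1 p2 p12 k by (metis divides_mult primes_coprime)
  have "\<not> coprime (l - i) k"
    using covers_if_shift_invariant_coprime[OF inv _ kpos X_nonempty[OF i(1)]] ncov by blast
  then have "p1 dvd l - i \<or> p2 dvd l - i"
    using k p1 p2 by (metis coprime_commute coprime_mult_left_iff prime_imp_coprime)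
  moreover have "[i = l] (mod p1)" if "p1 dvd l - i" using that by (metis cong_iff_dvd_diff cong_sym)
  moreover have "[i = l] (mod p2)" if "p2 dvd l - i" using that by (metis cong_iff_dvd_diff cong_sym)
  moreover have "stab i p1" if "p1 dvd l - i" using stab_if_divides[OF inv ncov that] nb that by blast
  moreover have "stab i p2" if "p2 dvd l - i"
    using sw.stab_if_divides[OF _ _ that] inv ncov nb that
    by (simp add: X_def sw.X_def stab_def sw.stab_def)
  ultimately show False using n by blast
qed

text \<open>
  The parameter \<open>d\<close>, here and in the next lemma, is one when the slope is to be raised and zero
  when the slope is already \<open>k + 1\<close>.
\<close>

lemma f_full_excess:
  assumes i: "i \<in> U" "l \<in> U" and cov: "covers (X i) k" and le: "n i \<le> n l" and d: "t - 1 + d \<le> k"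
  shows "n l - n i \<le> f i - d * n i"
proof -
  have "(t - 1 + d) * n i \<le> k * n i" using d n_pos[OF i(1)] by (intro mult_right_mono) auto
  moreover have "1 * (n l - n i) \<le> k * (n l - n i)" using kpos le by (intro mult_right_mono) auto
  ultimately show ?thesis using f_full[OF i cov] by (simp add: algebra_simps)
qed

lemma f_outside_excess:
  assumes pq: "prime q" "k = p * q" and i: "i \<in> U" and nc: "\<not> [i = r] (mod q)"
    and r: "r \<in> U" and d: "0 \<le> d" "d \<le> 1" "t - 1 + d \<le> k"
    and N: "N = (\<Sum>l\<in>{l\<in>U. [l = r] (mod q)}. n l)" and le: "p * n i \<le> N"
  shows "N - p * n i \<le> f i - d * n i"
proof -
  have q: "q \<ge> 1" using pq prime_gt_0_int[of q] by simp
  have p: "p \<ge> 1" using q kpos pq(2) zero_less_mult_iff[of p q] by simp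
  have dn: "d * n i \<le> p * n i" using d p n_pos[OF i] by (intro mult_right_mono) auto
  have "(t - 1 + d) * n i \<le> (p * q) * n i" using d pq(2) n_pos[OF i] by (intro mult_right_mono) auto
  moreover have "1 * (N - p * n i) \<le> q * (N - p * n i)" using q le by (intro mult_right_mono) auto
  ultimately show ?thesis using f_outside[OF pq i nc r] dn unfolding N[symmetric]
    by (auto simp: algebra_simps)
qed

lemma exists_outside1: "\<exists>m\<in>U. \<not> [m = r] (mod p1)"
proof -
  obtain a where a: "a \<in> A" "\<not> [a = r] (mod p1)" using nonconst1 by blast
  have "[a = a mod k] (mod p1)" using k by (intro cong_class) auto
  with a show ?thesis unfolding U_def using cong_trans by blast
qed

lemma exists_outside2: "\<exists>m\<in>U. \<not> [m = r] (mod p2)"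
proof -
  interpret sw: residue_classes p2 p1 k t c A by (rule swapped)
  show ?thesis using sw.exists_outside1 by (simp add: U_def sw.U_def)
qed

lemma obtain_largest:
  obtains m where "m \<in> U" "\<And>i. i \<in> U \<Longrightarrow> n i \<le> n m"
  using obtain_argmax[of U n] finU exists_outside1 by blast

text \<open>
  The surplus of a class is its excess over slope \<open>t + 1\<close>, with the constant \<open>c\<close>
  conceded for each class.
\<close>

lemma slope_step:
  assumes t: "t \<le> k"
  shows "(t + 1) * int (card A) - int (card U) * c \<le> int (card (A + k *o A))"
proof -
  obtain r where r: "r \<in> U" "\<And>i. i \<in> U \<Longrightarrow> n i \<le> n r" using obtain_largest by blast
  define Pa where "Pa = {i\<in>U. [i = r] (mod p2)}"
  define Pb where "Pb = {i\<in>U. [i = r] (mod p1)}"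
  define Ba where "Ba = {i\<in>Pa. stab i p2}"
  define Bb where "Bb = {i\<in>Pb. stab i p1}"
  define e where "e i = f i - n i" for i
  obtain ma where ma: "ma \<in> U - Pa" "\<And>i. i \<in> U - Pa \<Longrightarrow> n i \<le> n ma"
    using obtain_argmax[of "U - Pa" n] finU exists_outside2[of r] Pa_def by blast
  obtain mb where mb: "mb \<in> U - Pb" "\<And>i. i \<in> U - Pb \<Longrightarrow> n i \<le> n mb"
    using obtain_argmax[of "U - Pb" n] finU exists_outside1[of r] Pb_def by blast
  have k': "k = p2 * p1" using k by simp
  have full: "n r - n i \<le> e i" if "i \<in> U" "covers (X i) k" for i
    using f_full_excess[OF that(1) r(1) that(2) r(2)[OF that(1)], of 1] t by (simp add: e_def)
  have "surplus U r n e Pa Pb Ba Bb p1 p2 ma mb"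
  proof
    show "Pa \<inter> Pb = {r}"
    proof
      show "Pa \<inter> Pb \<subseteq> {r}"
      proof
        fix i assume "i \<in> Pa \<inter> Pb"
        then have i: "i \<in> U" "[i = r] (mod p1)" "[i = r] (mod p2)" by (auto simp: Pa_def Pb_def)
        have "coprime p1 p2" using p1 p2 p12 by (simp add: primes_coprime)
        then have "[i = r] (mod k)" unfolding k using i(2,3) by (metis coprime_cong_mult)
        then have "i = r" using U_bounds[OF i(1)] U_bounds[OF r(1)]
          by (simp add: cong_def)
        then show "i \<in> {r}" by simp
      qed
    qed (use r in \<open>auto simp: Pa_def Pb_def\<close>)
    show "p1 * n ma - n i \<le> e i" if "i \<in> Ba" for i
    proof -
      have "\<not> [ma = i] (mod p2)" "i \<in> U" "stab i p2" "ma \<in> U"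
        using that ma(1) cong_trans[of ma i p2 r] by (auto simp: Ba_def Pa_def)
      then show ?thesis using f_stab[OF p2 k] by (simp add: e_def)
    qed
    show "p2 * n mb - n i \<le> e i" if "i \<in> Bb" for i
    proof -
      have "\<not> [mb = i] (mod p1)" "i \<in> U" "stab i p1" "mb \<in> U"
        using that mb(1) cong_trans[of mb i p1 r] by (auto simp: Bb_def Pb_def)
      then show ?thesis using f_stab[OF p1 k'] by (simp add: e_def)
    qed
    show "sum n Pa - p1 * n ma \<le> e ma" if "p1 * n ma \<le> sum n Pa"
      using f_outside_excess[OF p2 k _ _ r(1), of ma 1 "sum n Pa"] ma(1) t that
      by (simp add: Pa_def e_def)
    show "sum n Pb - p2 * n mb \<le> e mb" if "p2 * n mb \<le> sum n Pb"
      using f_outside_excess[OF p1 k' _ _ r(1), of mb 1 "sum n Pb"] mb(1) t that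
      by (simp add: Pb_def e_def)
    show "n r - n i \<le> e i" if "i \<in> U - {r} - Ba - Bb" for i
    proof -
      from that have "i \<in> U" "r \<noteq> i" "\<not> (stab i p1 \<and> [i = r] (mod p1))"
        "\<not> (stab i p2 \<and> [i = r] (mod p2))"
        by (auto simp: Ba_def Bb_def Pa_def Pb_def)
      with trichotomy[of i r] r(1) have "covers (X i) k \<or> n r \<le> f i" by blast
      then show ?thesis using full \<open>i \<in> U\<close> by (auto simp: e_def)
    qed
    show "2 \<le> p1" "2 \<le> p2" using p1 p2 by (simp_all add: prime_ge_2_int)
  qed (use finU r n_pos ma mb in \<open>auto simp: Pa_def Pb_def Ba_def Bb_def\<close>)
  then have "0 \<le> sum e U"
  proof (rule surplus.sum_surplus_nonneg)
    show "r \<in> Ba \<union> Bb \<or> 0 \<le> e r \<or> (\<forall>l\<in>U - {r}. n l - n r \<le> e r)"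
    proof (cases "covers (X r) k \<or> r \<in> Ba \<union> Bb")
      case True
      then show ?thesis using full[OF r(1)] by auto
    next
      case False
      then have "\<not> stab r p1" "\<not> stab r p2" using r(1) by (auto simp: Ba_def Bb_def Pa_def Pb_def)
      then have "n l - n r \<le> e r" if "l \<in> U - {r}" for l
        using trichotomy[OF r(1), of l] that False by (auto simp: e_def)
      then show ?thesis by blast
    qed
  qed
  also have "sum e U = int (card (A + k *o A)) - (t + 1) * int (card A) + int (card U) * c"
    unfolding e_def f_def card_dilate sum_n[symmetric]
    by (simp add: sum.distrib sum_subtractf sum_distrib_left algebra_simps)
  finally show ?thesis by linarith
qed

lemma sum_f_pair_le:
  assumes "i \<in> U" "m \<in> U" "i \<noteq> m"
  shows "f i + f m \<le> sum f U"
proof -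
  have "sum f {i, m} \<le> sum f U" using assms f_nonneg by (intro sum_mono2 finU) auto
  then show ?thesis using assms(3) by simp
qed

lemma f_le_sum: "i \<in> U \<Longrightarrow> f i \<le> sum f U"
  using f_nonneg finU by (intro member_le_sum) auto

text \<open>
  The class \<open>i\<close> gains \<open>p * n m\<close>. If this is less than \<open>n r\<close>, then \<open>m\<close> gains
  the difference to the size of the whole residue class of \<open>r\<close> modulo \<open>q\<close>.
\<close>

lemma gain_from_stab:
  assumes pq: "prime q" "k = p * q" and t: "t \<le> k + 1"
    and i: "i \<in> U" "stab i q" "[i = r] (mod q)" and r: "r \<in> U" and m: "m \<in> U" "\<not> [m = r] (mod q)"
  shows "n r \<le> sum f U"
proof -
  have "\<not> [m = i] (mod q)" using m(2) i(3) cong_trans by blast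
  then have fi: "p * n m \<le> f i" using f_stab[OF pq i(1) m(1) i(2)] by blast
  show ?thesis
  proof (cases "n r \<le> p * n m")
    case True
    then show ?thesis using fi f_le_sum[OF i(1)] by linarith
  next
    case False
    define N where "N = (\<Sum>l\<in>{l\<in>U. [l = r] (mod q)}. n l)"
    have "n r \<le> N" unfolding N_def
      using r n_pos finU by (intro member_le_sum) (auto intro!: less_imp_le)
    then have "N - p * n m \<le> f m"
      using f_outside_excess[OF pq m r, of 0 N] N_def t False by simp
    moreover have "i \<noteq> m" using i(3) m(2) by auto
    ultimately show ?thesis using sum_f_pair_le[OF i(1) m(1)] fi \<open>n r \<le> N\<close> by linarith
  qed
qed

text \<open>
  A non-full class other than \<open>r\<close> gains \<open>n r\<close> directly or through invariance. If only
  \<open>r\<close> is not full, it gains the size of some other class, and that class, being full, gains the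
  difference to \<open>n r\<close>.
\<close>

lemma gain_if_not_full:
  assumes t: "t \<le> k + 1" and ex: "\<exists>i\<in>U. \<not> covers (X i) k"
    and r: "r \<in> U" "\<And>i. i \<in> U \<Longrightarrow> n i \<le> n r"
  shows "n r \<le> sum f U"
proof -
  have k': "k = p2 * p1" using k by simp
  obtain m1 m2 where m: "m1 \<in> U" "\<not> [m1 = r] (mod p1)" "m2 \<in> U" "\<not> [m2 = r] (mod p2)"
    using exists_outside1 exists_outside2 by meson
  have st: "n r \<le> sum f U"
    if "i \<in> U" "(stab i p1 \<and> [i = r] (mod p1)) \<or> (stab i p2 \<and> [i = r] (mod p2))" for i
    using that gain_from_stab[OF p1 k' t _ _ _ r(1) m(1,2)] gain_from_stab[OF p2 k t _ _ _ r(1) m(3,4)] by blast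
  show ?thesis
  proof (cases "\<exists>i\<in>U. i \<noteq> r \<and> \<not> covers (X i) k")
    case True
    then obtain i where i: "i \<in> U" "r \<noteq> i" "\<not> covers (X i) k" by blast
    then show ?thesis using trichotomy[OF i(1) r(1) i(2)] st[OF i(1)] f_le_sum[OF i(1)] by linarith
  next
    case False
    then have nr: "\<not> covers (X r) k" using ex by (cases "covers (X r) k") auto
    have m1r: "m1 \<noteq> r" using m(2) by auto
    then have cov: "covers (X m1) k" using False m(1) by blast
    have "stab r p1 \<or> stab r p2 \<or> n m1 \<le> f r"
      using trichotomy[OF r(1) m(1) m1r] nr by blast
    moreover have "n r - n m1 \<le> f m1"
      using f_full_excess[OF m(1) r(1) cov r(2)[OF m(1)], of 0] t by simp
    ultimately show ?thesis using st[OF r(1)] sum_f_pair_le[OF r(1) m(1)] m1r by force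
  qed
qed

end

section \<open>The case in which every fibre is full\<close>

text \<open>
  The smallest element of \<open>X\<close> plus a minimum below \<open>lo i\<close> is smaller than every element of
  \<open>X + B\<close>, and likewise at the upper end.
\<close>

lemma card_sumset_extremes_ge:
  fixes lo hi :: "int \<Rightarrow> int"
  assumes fin: "finite X" "X \<noteq> {}" "finite A" "finite J"
    and inj: "inj_on lo J" "inj_on hi J"
    and sub: "lo ` J \<subseteq> A" "hi ` J \<subseteq> A" "B \<subseteq> A"
    and B: "\<And>b. b \<in> B \<Longrightarrow> lo i \<le> b \<and> b \<le> hi i" "B \<noteq> {}"
  shows "int (card (X + B)) + int (card {l\<in>J. lo l < lo i}) + int (card {l\<in>J. hi i < hi l})
    \<le> int (card (X + A))"
proof -
  let ?L = "(\<lambda>l. Min X + lo l) ` {l\<in>J. lo l < lo i}"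
  let ?H = "(\<lambda>l. Max X + hi l) ` {l\<in>J. hi i < hi l}"
  have X: "Min X \<in> X" "Max X \<in> X" "\<And>x. x \<in> X \<Longrightarrow> Min X \<le> x \<and> x \<le> Max X" using fin by auto
  have bnd: "Min X + lo i \<le> y \<and> y \<le> Max X + hi i" if "y \<in> X + B" for y
    using that X(3) B(1) by (fastforce elim!: set_plus_elim intro: add_mono)
  have d1: "(X + B) \<inter> ?L = {}" "(X + B) \<inter> ?H = {}" using bnd by force+
  obtain y where "y \<in> X + B" using fin(2) B(2) by (auto intro: set_plus_intro)
  then have "Min X + lo i \<le> Max X + hi i" using bnd by fastforce
  then have d2: "?L \<inter> ?H = {}" by auto
  have fs: "finite (X + A)" "finite (X + B)"
    using fin sub(3) by (auto intro!: finite_sumset intro: finite_subset)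
  have "card (X + B) + card ?L + card ?H = card (X + B \<union> ?L \<union> ?H)"
    using fs fin d1 d2 by (subst card_Un_disjoint; (subst card_Un_disjoint)?) auto
  also have "\<dots> \<le> card (X + A)"
  proof (intro card_mono fs Un_least)
    show "X + B \<subseteq> X + A" using sub(3) by (intro set_plus_mono2) auto
    show "?L \<subseteq> X + A" "?H \<subseteq> X + A" using sub(1,2) X(1,2) by (auto intro!: set_plus_intro)
  qed
  also have "card ?L = card {l\<in>J. lo l < lo i}"
    using inj(1) by (intro card_image) (auto simp: inj_on_def)
  also have "card ?H = card {l\<in>J. hi i < hi l}"
    using inj(2) by (intro card_image) (auto simp: inj_on_def)
  finally show ?thesis by linarith
qed

text \<open>
  Reversing a pair exchanges the two counts.
\<close>

lemma sum_card_less_pairs: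
  fixes g :: "'a \<Rightarrow> int"
  assumes "finite J" "inj_on g J"
  shows "(\<Sum>i\<in>J. int (card {l\<in>J. g l < g i})) + (\<Sum>i\<in>J. int (card {l\<in>J. g i < g l}))
      = int (card J) * (int (card J) - 1)"
    and "(\<Sum>i\<in>J. int (card {l\<in>J. g l < g i})) = (\<Sum>i\<in>J. int (card {l\<in>J. g i < g l}))"
proof -
  have "int (card {l\<in>J. g l < g i}) + int (card {l\<in>J. g i < g l}) = int (card J) - 1" if i: "i \<in> J" for i
  proof -
    have eq: "J - {i} = {l\<in>J. g l < g i} \<union> {l\<in>J. g i < g l}"
    proof (intro equalityI subsetI)
      fix l assume l: "l \<in> J - {i}"
      then have "g l \<noteq> g i" using inj_onD[OF assms(2), of l i] i by auto
      with l show "l \<in> {l\<in>J. g l < g i} \<union> {l\<in>J. g i < g l}" by auto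
    qed auto
    have "card (J - {i}) = card {l\<in>J. g l < g i} + card {l\<in>J. g i < g l}"
      unfolding eq using assms(1) by (intro card_Un_disjoint) auto
    moreover have "card J = Suc (card (J - {i}))" by (rule card.remove[OF assms(1) i])
    ultimately show ?thesis by simp
  qed
  then show "(\<Sum>i\<in>J. int (card {l\<in>J. g l < g i})) + (\<Sum>i\<in>J. int (card {l\<in>J. g i < g l}))
      = int (card J) * (int (card J) - 1)"
    by (simp flip: sum.distrib)
  have cnt: "card {l\<in>J. P l} = (\<Sum>l\<in>J. if P l then 1 else 0)" for P
    using assms(1) by (simp flip: sum.inter_filter)
  have "(\<Sum>i\<in>J. card {l\<in>J. g l < g i}) = (\<Sum>i\<in>J. \<Sum>l\<in>J. if g l < g i then 1 else 0)"
    by (simp only: cnt)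
  also have "\<dots> = (\<Sum>l\<in>J. \<Sum>i\<in>J. if g l < g i then 1 else 0)" by (rule sum.swap)
  also have "\<dots> = (\<Sum>i\<in>J. card {l\<in>J. g i < g l})"
    by (simp only: cnt)
  finally show "(\<Sum>i\<in>J. int (card {l\<in>J. g l < g i})) = (\<Sum>i\<in>J. int (card {l\<in>J. g i < g l}))"
    unfolding of_nat_sum[symmetric] by (rule arg_cong)
qed

text \<open>
  A full fibre gives \<open>(k + 1) * n i - k\<close> sums already with its own class. Ordering the classes by
  their minima, and again by their maxima, each unordered pair of classes contributes one further sum
  for each of the two orders, \<open>j * (j - 1)\<close> in total.
\<close>

lemma (in residue_classes) bound_if_all_full:
  assumes cov: "\<And>i. i \<in> U \<Longrightarrow> covers (X i) k"
  shows "(k + 1) * int (card A) - int (card U) * (k + 1 - int (card U)) \<le> int (card (A + k *o A))"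
proof -
  define C where "C i = {a \<in> A. a mod k = i}" for i
  define lo where "lo i = Min (C i)" for i
  define hi where "hi i = Max (C i)" for i
  have C: "finite (C i)" "C i \<subseteq> A" for i using finA by (auto simp: C_def)
  have ne: "C i \<noteq> {}" if "i \<in> U" for i using that by (auto simp: C_def U_def)
  have loC: "lo i \<in> C i" "hi i \<in> C i" if "i \<in> U" for i
    using ne[OF that] C by (auto simp: lo_def hi_def)
  have inj: "inj_on lo U" "inj_on hi U"
    using loC by (intro inj_onI; simp add: C_def; metis)+
  let ?a = "\<lambda>i. int (card {l\<in>U. lo l < lo i})" and ?b = "\<lambda>i. int (card {l\<in>U. hi i < hi l})"
  have "(k + 1) * n i - k + ?a i + ?b i \<le> int (card (X i + A))" if i: "i \<in> U" for i
  proof -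
    have "int (card (X i)) + k * (int (card (C i)) - 1) \<le> int (card (X i + C i))"
      using cov[OF i] kpos ne[OF i] C
      by (intro card_sumset_covers_ge[OF finX, where b = i]) (auto simp: C_def intro: cong_class)
    moreover have "int (card (X i + C i)) + ?a i + ?b i \<le> int (card (X i + A))"
    proof (rule card_sumset_extremes_ge[OF finX X_nonempty[OF i] finA finU inj])
      show "lo ` U \<subseteq> A" "hi ` U \<subseteq> A" using loC C(2) by blast+
      show "lo i \<le> x \<and> x \<le> hi i" if "x \<in> C i" for x using that C(1)[of i] unfolding lo_def hi_def by simp
    qed (use C ne[OF i] in auto)
    ultimately show ?thesis using n_class[OF i] by (simp add: C_def n_def algebra_simps)
  qed
  then have "(\<Sum>i\<in>U. (k + 1) * n i - k + ?a i + ?b i) \<le> int (card (A + k *o A))"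
    unfolding card_dilate by (intro sum_mono)
  moreover have "(\<Sum>i\<in>U. (k + 1) * n i - k + ?a i + ?b i)
     = (k + 1) * int (card A) - int (card U) * k + (sum ?a U + sum ?b U)"
    unfolding sum_n[symmetric] by (simp add: sum.distrib sum_subtractf sum_distrib_left)
  moreover have "2 * sum ?a U = int (card U) * (int (card U) - 1)"
    using sum_card_less_pairs[OF finU inj(1)] by linarith
  moreover have "2 * sum ?b U = int (card U) * (int (card U) - 1)"
    using sum_card_less_pairs[OF finU inj(2)] by linarith
  ultimately show ?thesis by (simp add: algebra_simps)
qed

section \<open>The weak bound and the theorem\<close>

text \<open>
  Divide all differences by their greatest common divisor.
\<close>

lemma nonconstant_affine_copy:
  fixes A :: "int set"
  assumes A: "finite A" "2 \<le> card A"
  obtains A' where "finite A'" "card A' = card A" "\<And>k. card (A' + k *o A') = card (A + k *o A)"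
    "\<And>d r. 1 < d \<Longrightarrow> \<exists>a\<in>A'. \<not> [a = r] (mod d)"
proof -
  obtain a0 where a0: "a0 \<in> A" using A by fastforce
  define g where "g = (GCD a\<in>A. a - a0)"
  define \<phi> where "\<phi> x = a0 + g * x" for x
  define A' where "A' = {x. \<phi> x \<in> A}"
  have gd: "g dvd a - a0" if "a \<in> A" for a using that unfolding g_def by (intro Gcd_dvd) auto
  have g0: "g \<ge> 0" unfolding g_def by simp
  have "g \<noteq> 0"
  proof
    assume "g = 0"
    then have "A \<subseteq> {a0}" using gd by auto
    then have "card A \<le> 1" by (metis card_mono card.empty card_insert_if empty_iff finite.emptyI finite.insertI One_nat_def)
    with A show False by simp
  qed
  with g0 have g: "g > 0" by simp
  have inj: "inj \<phi>" using g by (auto simp: inj_def \<phi>_def)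
  have im: "A = \<phi> ` A'"
  proof
    show "A \<subseteq> \<phi> ` A'"
    proof
      fix a assume a: "a \<in> A"
      obtain x where "a - a0 = g * x" using gd[OF a] by blast
      then have "a = \<phi> x" by (simp add: \<phi>_def)
      with a show "a \<in> \<phi> ` A'" by (auto simp: A'_def)
    qed
  qed (auto simp: A'_def)
  have fin: "finite A'" using A(1) im inj by (metis finite_imageD inj_on_subset subset_UNIV)
  have card: "card A' = card A" unfolding im by (metis card_image inj inj_on_subset subset_UNIV)
  have dil: "card (A' + k *o A') = card (A + k *o A)" for k
  proof -
    let ?\<psi> = "\<lambda>y. (1 + k) * a0 + g * y"
    have "A + k *o A = ?\<psi> ` (A' + k *o A')"
    proof (intro equalityI subsetI)
      fix w assume "w \<in> A + k *o A"
      then obtain x y where xy: "x \<in> A'" "y \<in> A'" "w = \<phi> x + k * \<phi> y"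
        unfolding im by (auto elim!: set_plus_elim simp: elt_set_times_def)
      then have "w = ?\<psi> (x + k * y)" by (simp add: \<phi>_def algebra_simps)
      moreover have "x + k * y \<in> A' + k *o A'" using xy by (auto simp: elt_set_times_def)
      ultimately show "w \<in> ?\<psi> ` (A' + k *o A')" by blast
    next
      fix w assume "w \<in> ?\<psi> ` (A' + k *o A')"
      then obtain x y where xy: "x \<in> A'" "y \<in> A'" "w = ?\<psi> (x + k * y)"
        by (auto elim!: set_plus_elim simp: elt_set_times_def)
      then have "w = \<phi> x + k * \<phi> y" by (simp add: \<phi>_def algebra_simps)
      moreover have "\<phi> x \<in> A" "k * \<phi> y \<in> k *o A" using xy by (auto simp: A'_def elt_set_times_def)
      ultimately show "w \<in> A + k *o A" by blast
    qed
    then show ?thesis using g by (simp add: card_image inj_on_def)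
  qed
  have nc: "\<exists>a\<in>A'. \<not> [a = r] (mod d)" if d: "1 < d" for d r
  proof (rule ccontr)
    assume "\<not> ?thesis"
    then have all: "[a = r] (mod d)" if "a \<in> A'" for a using that by blast
    have z: "0 \<in> A'" using a0 by (simp add: A'_def \<phi>_def)
    have dx: "d dvd x" if "x \<in> A'" for x
      using all[OF that] all[OF z] by (metis cong_0_iff cong_sym cong_trans)
    have "d * g dvd a - a0" if "a \<in> A" for a
    proof -
      have "a \<in> \<phi> ` A'" using that by (subst (asm) im)
      then obtain x where "x \<in> A'" "a = \<phi> x" by blast
      have "d * g dvd x * g" using dx[OF \<open>x \<in> A'\<close>] by (rule mult_dvd_mono) simp
      then show ?thesis using \<open>a = \<phi> x\<close> by (simp add: \<phi>_def mult.commute)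
    qed
    then have "d * g dvd g" unfolding g_def by (intro Gcd_greatest) auto
    then have "d * g dvd 1 * g" by simp
    then have "d dvd 1" using g unfolding dvd_mult_cancel_right by simp
    with d show False by (simp add: zdvd1_eq)
  qed
  show ?thesis using that fin card dil nc by blast
qed

lemma card_dilate:
  fixes A :: "int set"
  assumes "k \<noteq> 0"
  shows "card (k *o A) = card A"
proof -
  have "k *o A = (*) k ` A" by (auto simp: elt_set_times_def)
  then show ?thesis using assms by (simp add: card_image inj_on_def)
qed

lemma card_residues_le:
  fixes A :: "int set"
  assumes "k > 0"
  shows "int (card ((\<lambda>a. a mod k) ` A)) \<le> k"
proof -
  have "card ((\<lambda>a. a mod k) ` A) \<le> card {0..<k}"
    using assms by (intro card_mono) auto
  then show ?thesis using assms by simp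
qed

text \<open>
  Induction on the slope \<open>t = s + 2\<close>, which starts from the basic bound for sumsets.
\<close>

lemma dilate_slope_bound:
  fixes p1 p2 k :: int and Y :: "int set"
  assumes p: "prime p1" "prime p2" "p1 \<noteq> p2" "k = p1 * p2"
    and Y: "finite Y" "Y \<noteq> {}" and s: "int s + 1 \<le> k"
  shows "(int s + 2) * int (card Y) - k * fact s \<le> int (card (Y + k *o Y))"
  using Y s
proof (induction s arbitrary: Y)
  case 0
  have kp: "k > 0" using p by (simp add: prime_gt_0_int)
  have "finite (k *o Y)" "k *o Y \<noteq> {}" using 0 by (auto simp: elt_set_times_def)
  then show ?case using card_sumset_ge[of Y "k *o Y"] card_dilate[of k Y] 0 kp by simp
next
  case (Suc s)
  have kp: "k > 0" using p by (simp add: prime_gt_0_int)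
  have f1: "k \<le> k * fact s" for s using kp by simp
  have card_pos: "card Y \<ge> 1" using Suc.prems by (simp add: Suc_leI card_gt_0_iff)
  show ?case
  proof (cases "card Y = 1")
    case True
    have "finite (k *o Y)" "k *o Y \<noteq> {}" using Suc.prems by (auto simp: elt_set_times_def)
    then have "1 \<le> int (card (Y + k *o Y))"
      using card_sumset_ge[of Y "k *o Y"] card_dilate[of k Y] Suc.prems kp True by simp
    moreover have "(int (Suc s) + 2) * int (card Y) = int (Suc s) + 2" using True by simp
    ultimately show ?thesis using f1[of "Suc s"] Suc.prems(3) by linarith
  next
    case False
    then have "2 \<le> card Y" using card_pos by simp
    then obtain A where A: "finite A" "card A = card Y" "\<And>k. card (A + k *o A) = card (Y + k *o Y)"
      "\<And>d r. 1 < d \<Longrightarrow> \<exists>a\<in>A. \<not> [a = r] (mod d)"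
      using nonconstant_affine_copy[OF Suc.prems(1)] by metis
    have pgt: "1 < p1" "1 < p2" using p by (simp_all add: prime_gt_1_int)
    interpret residue_classes p1 p2 k "int s + 2" "k * fact s" A
    proof
      show "(int s + 2) * int (card Z) - k * fact s \<le> int (card (Z + k *o Z))"
        if "finite Z" "Z \<noteq> {}" for Z
        using Suc.IH[OF that] Suc.prems(3) by simp
      show "\<exists>a\<in>A. \<not> [a = r] (mod p1)" "\<exists>a\<in>A. \<not> [a = r] (mod p2)" for r
        by (rule A(4)[OF pgt(1)], rule A(4)[OF pgt(2)])
    qed (fact p A(1) f1)+
    let ?j = "int (card U)"
    have j: "?j \<le> k" using card_residues_le[OF kpos] by (simp add: U_def)
    show ?thesis
    proof (cases "?j \<le> int s + 1")
      case True
      have "?j * (k * fact s) \<le> (int s + 1) * (k * fact s)" using True kp by (intro mult_right_mono) auto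
      also have "\<dots> = k * fact (Suc s)" by (simp add: algebra_simps)
      finally show ?thesis
        using slope_step Suc.prems(3) A(2,3) by (simp add: algebra_simps)
    next
      case False
      then have "(int s + 2) * int (card A) \<le> ?j * int (card A)" by (intro mult_right_mono) auto
      moreover have "A \<noteq> {}" using A(2) card_pos by auto
      then have "int (card A) + ?j * (int (card A) - 1) \<le> int (card (A + k *o A))"
        using card_dilate_sumset_residues_ge[OF A(1) _ kpos] by (simp add: U_def)
      ultimately show ?thesis using j f1[of "Suc s"] A(2,3) by (simp add: algebra_simps)
    qed
  qed
qed

text \<open>
  By the inequality of arithmetic and geometric means, four times the left-hand side is at most
  \<open>(k + 1)\<^sup>2 = k * (k + 2) + 1\<close>; the excess of a quarter disappears in the ceiling.
\<close>

lemma product_le_ceiling: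
  fixes j k :: int
  shows "j * (k + 1 - j) \<le> \<lceil>real_of_int (k * (k + 2)) / 4\<rceil>"
proof -
  have "0 \<le> (k + 1 - 2 * j)\<^sup>2" by simp
  then have "4 * (j * (k + 1 - j)) - 4 < k * (k + 2)" by (simp add: power2_eq_square algebra_simps)
  then have "real_of_int (4 * (j * (k + 1 - j)) - 4) < real_of_int (k * (k + 2))" by (rule of_int_less_iff[THEN iffD2])
  then have "real_of_int (j * (k + 1 - j)) - 1 < real_of_int (k * (k + 2)) / 4" by simp
  then show ?thesis by (simp only: le_ceiling_iff)
qed

lemma dilate_bound_int:
  fixes p1 p2 k :: int and A :: "int set"
  assumes p: "prime p1" "prime p2" "p1 \<noteq> p2" "k = p1 * p2"
    and A: "finite A" "(k - 1)\<^sup>2 * fact (nat k) \<le> int (card A)"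
  shows "(k + 1) * int (card A) - \<lceil>real_of_int (k * (k + 2)) / 4\<rceil> \<le> int (card (A + k *o A))"
proof -
  have pgt: "1 < p1" "1 < p2" using p by (simp_all add: prime_gt_1_int)
  have "2 * 2 \<le> p1 * p2" using pgt by (intro mult_mono) auto
  then have k4: "k \<ge> 4" using p(4) by simp
  define s where "s = nat (k - 1)"
  have s: "nat k = Suc s" "int s = k - 1" using k4 by (auto simp: s_def)
  have ks: "k * fact s = (fact (nat k) :: int)" unfolding s(1) using s(2) by simp
  let ?F = "fact (nat k) :: int"
  have F1: "k \<le> ?F" unfolding ks[symmetric] using k4 by simp
  have "1 * ?F \<le> (k - 1)\<^sup>2 * ?F" using k4 by (intro mult_right_mono) (auto simp: power2_eq_square intro: order_trans[of 1 "k - 1"] self_le_power)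
  then have c2: "2 \<le> card A" using F1 k4 A(2) by linarith
  then obtain B where B: "finite B" "card B = card A" "\<And>k. card (B + k *o B) = card (A + k *o A)"
      "\<And>d r. 1 < d \<Longrightarrow> \<exists>a\<in>B. \<not> [a = r] (mod d)"
    using nonconstant_affine_copy[OF A(1)] by metis
  interpret residue_classes p1 p2 k "k + 1" ?F B
  proof
    show "(k + 1) * int (card X) - ?F \<le> int (card (X + k *o X))" if "finite X" "X \<noteq> {}" for X
      using dilate_slope_bound[OF p that, of s] s(2) ks by (simp add: algebra_simps)
    show "\<exists>a\<in>B. \<not> [a = r] (mod p1)" "\<exists>a\<in>B. \<not> [a = r] (mod p2)" for r
      by (rule B(4)[OF pgt(1)], rule B(4)[OF pgt(2)])
  qed (fact p B(1) F1)+
  let ?j = "int (card U)"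
  have j: "?j \<le> k" using card_residues_le[of k B] k4 by (simp add: U_def)
  have "(k + 1) * int (card B) - ?j * (k + 1 - ?j) \<le> int (card (B + k *o B))
      \<or> (k + 1) * int (card B) \<le> int (card (B + k *o B))"
  proof (cases "?j = k")
    case True
    have "B \<noteq> {}" using B(2) c2 by auto
    then have "int (card B) + ?j * (int (card B) - 1) \<le> int (card (B + k *o B))"
      using card_dilate_sumset_residues_ge[OF B(1) _ kpos] by (simp add: U_def)
    with True show ?thesis by (simp add: algebra_simps)
  next
    case jk: False
    show ?thesis
    proof (cases "\<forall>i\<in>U. covers (X i) k")
      case True
      then show ?thesis using bound_if_all_full by blast
    next
      case False
      obtain r where r: "r \<in> U" "\<And>i. i \<in> U \<Longrightarrow> n i \<le> n r" using obtain_largest by blast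
      have j1: "?j \<le> k - 1" using j jk by linarith
      (* The largest of at most k - 1 classes contains the average share of the elements. *)
      have "(k - 1) * ?F \<le> n r"
      proof (rule ccontr)
        assume "\<not> ?thesis"
        then have lt: "n r < (k - 1) * ?F" by simp
        have "int (card B) = sum n U" by (rule sum_n[symmetric])
        also have "\<dots> \<le> ?j * n r" using sum_bounded_above[of U n "n r"] r(2) by simp
        also have "\<dots> \<le> (k - 1) * n r" using j1 n_pos[OF r(1)] by (intro mult_right_mono) auto
        also have "\<dots> < (k - 1) * ((k - 1) * ?F)" using lt k4 by (intro mult_strict_left_mono) auto
        finally show False using A(2) B(2) by (simp add: power2_eq_square mult.assoc)
      qed
      moreover have "?j * ?F \<le> (k - 1) * ?F" using j1 by (intro mult_right_mono) auto
      moreover have "n r \<le> sum f U" using False r by (intro gain_if_not_full) auto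
      moreover have "sum f U = int (card (B + k *o B)) - (k + 1) * int (card B) + ?j * ?F"
        unfolding f_def card_dilate sum_n[symmetric]
        by (simp add: sum.distrib sum_subtractf sum_distrib_left)
      ultimately show ?thesis by linarith
    qed
  qed
  moreover have "?j * (k + 1 - ?j) \<le> \<lceil>real_of_int (k * (k + 2)) / 4\<rceil>" by (rule product_le_ceiling)
  moreover have "0 \<le> ?j * (k + 1 - ?j)" using j by simp
  ultimately show ?thesis using B(2,3) by force
qed

theorem theorem2:
  fixes p1 p2 k :: nat and A :: "int set"
  assumes "prime p1" and "prime p2" and "p1 \<noteq> p2"
    and "k = p1 * p2"
    and "finite A"
    and "card A \<ge> (k - 1)^2 * fact k"
  shows "int (card (A + int k *o A))
           \<ge> (int k + 1) * int (card A) - \<lceil>real (k * (k + 2)) / 4\<rceil>"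
proof -
  have "k \<ge> 1" using assms(1,2,4) by (simp add: prime_gt_0_nat Suc_leI)
  have "int ((k - 1)^2 * fact k) \<le> int (card A)" using assms(6) by (rule of_nat_mono)
  then have "(int k - 1)\<^sup>2 * fact (nat (int k)) \<le> int (card A)"
    using \<open>k \<ge> 1\<close> by (simp add: of_nat_diff)
  then have "(int k + 1) * int (card A) - \<lceil>real_of_int (int k * (int k + 2)) / 4\<rceil>
      \<le> int (card (A + int k *o A))"
    using assms(1-5) by (intro dilate_bound_int[of "int p1" "int p2"]) simp_all
  moreover have "real_of_int (int k * (int k + 2)) = real (k * (k + 2))" by (simp add: algebra_simps)
  ultimately show ?thesis by metis
qed

end
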